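(* For each $k\in\{0,1,2,\dots\}$ there exist polynomials $P_{k,0},\dots,P_{k,2k}\in\mathbb{Q}[x]$ such that for all $n$ $$M(d^k;n):=\sum_{\lambda\in\Pi(n)}d(\lambda)^k=P_{k,2k}(n)B_{n+2k}+P_{k,2k-1}(n)B_{n+2k-1}+\dots+P_{k,0}(n)B_n,$$ where the degree of $P_{k,2k-j}$ is at most $j$ if $j\le k$ and at most $k-\lceil\frac{j-k}{2}\rceil$ if $j>k$. For example, $$\sum_{\lambda\in\Pi(n)}d(\lambda)=-2B_{n+2}+(n+4)B_{n+1},$$ $$\sum_{\lambda\in\Pi(n)}d(\lambda)^2=4B_{n+4}-(4n+15)B_{n+3}+(n^2+8n+9)B_{n+2}-(4n+3)B_{n+1}+nB_n.$$
   Context: $\Pi(n)$ is the set of set partitions of $[n]=\{1,\dots,n\}$ and $B_n=|\Pi(n)|$ is the $n$th Bell number. For $\lambda\in\Pi(n)$ with blocks $\mathbf{B}_1,\dots,\mathbf{B}_\ell$, the dimension exponent is $d(\lambda)=\sum_{i=1}^{\ell}(\max\mathbf{B}_i-\min\mathbf{B}_i+1)-n$; equivalently $d(\lambda)=\sum_{(e,f)}(f-e-1)$, the sum over pairs $e<f$ in the same block with no element of that block strictly between them. *)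

theory Defs
  imports
    Complex_Main
    "HOL-Library.Disjoint_Sets"
    "HOL-Computational_Algebra.Polynomial"
begin

definition set_partitions :: "nat \<Rightarrow> nat set set set" where
  "set_partitions n = {\<pi>. partition_on {1..n} \<pi>}"

definition bell :: "nat \<Rightarrow> nat" where
  "bell n = card (set_partitions n)"

(* Integer-valued, so that the subtractions do not truncate. *)
definition dim_exponent :: "nat \<Rightarrow> nat set set \<Rightarrow> int" where
  "dim_exponent n \<pi> = (\<Sum>B\<in>\<pi>. int (Max B) - int (Min B) + 1) - int n"

definition dim_moment :: "nat \<Rightarrow> nat \<Rightarrow> int" where
  "dim_moment k n = (\<Sum>\<pi>\<in>set_partitions n. dim_exponent n \<pi> ^ k)"

end

theory Submission
  imports Defs
begin

text \<open>
  Cut a set partition after its first \<open>n\<close> elements and record the set \<open>S\<close> of blocks that are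
  still open. If \<open>m\<close> blocks are open, the next element adds \<open>m\<close> to the dimension exponent when it
  starts a block and \<open>m - 1\<close> when it continues one of them. Weighting the open blocks with the
  Charlier polynomial of degree \<open>m\<close> turns this transfer rule into operators on \<open>\<rat>[v]\<close>: with
  \<open>Y f (v) = v f (v - 1)\<close>, \<open>D f (v) = f (v + 1)\<close> and \<open>Z = (Y - 1) (D - 1)\<close>, whose eigenvectors are the
  Charlier polynomials, the weighted moments satisfy
  \<open>\<phi>\<^sub>k (n + 1) = (\<Sum>j\<le>k. (k choose j) Y Z\<^sup>j D \<phi>\<^bsub>k-j\<^esub> (n))\<close>, and \<open>M(d\<^sup>k; n) = L (\<phi>\<^sub>k (n))\<close> for the linear
  functional \<open>L\<close> with \<open>L 1 = 1\<close> and \<open>L \<circ> Y = L\<close>, which sends \<open>v\<^sup>n\<close> to the Bell number \<open>B\<^sub>n\<close>.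

  Since \<open>Y D\<close> is multiplication by \<open>v\<close>, the recurrence is first order and is solved
  explicitly: \<open>\<phi>\<^sub>k\<close> is a combination of \<open>Y\<^sup>b n\<^sup>e v\<^bsup>n+i\<^esup>\<close> and \<open>D\<^sup>b n\<^sup>e v\<^bsup>n+i\<^esup>\<close> with \<open>b + e + i \<le> 2k\<close> and
  \<open>2e - i \<le> k\<close> (even \<open>2e - i < k\<close> if \<open>b \<noteq> 0\<close>). After applying \<open>L\<close>, the two inequalities
  \<open>e + i \<le> 2k\<close> and \<open>2e \<le> k + i\<close> for the terms \<open>n\<^sup>e B\<^bsub>n+i\<^esub>\<close> are exactly the asserted degree bounds.
\<close>

section \<open>Set partitions with open blocks\<close>

lemma partition_on_insert_singleton:
  assumes "partition_on A P" "a \<notin> A"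
  shows "partition_on (insert a A) (insert {a} P)"
  using assms unfolding partition_on_def disjoint_def by auto

lemma partition_on_insert_into_block:
  assumes "partition_on A P" "a \<notin> A" "B \<in> P"
  shows "partition_on (insert a A) (insert (insert a B) (P - {B}))"
  using assms unfolding partition_on_def disjoint_def by (auto; blast)

text \<open>The cases are whether the block containing \<open>a\<close> is the singleton or not;
  deleting \<open>a\<close> from that block undoes the insertion.\<close>

lemma partition_on_insert_cases:
  assumes Q: "partition_on (insert a A) Q" and a: "a \<notin> A"
  obtains P where "partition_on A P" "Q = insert {a} P"
  | P B where "partition_on A P" "B \<in> P" "Q = insert (insert a B) (P - {B})"
proof -
  obtain C where C: "C \<in> Q" "a \<in> C"
    using Q unfolding partition_on_def by blast
  have uniq: "\<And>E. E \<in> Q \<Longrightarrow> E \<noteq> C \<Longrightarrow> E \<inter> C = {}"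
    using Q C unfolding partition_on_def disjoint_def by blast
  have ne: "{} \<notin> Q" and un: "\<Union>Q = insert a A"
    using Q unfolding partition_on_def by auto
  show thesis
  proof (cases "C = {a}")
    case True
    have "partition_on A (Q - {C})"
    proof (rule partition_onI)
      show "\<Union>(Q - {C}) = A"
      proof -
        have "\<Union>(Q - {C}) = \<Union>Q - C"
          using C uniq by blast
        then show ?thesis using un True a by auto
      qed
      show "\<And>p q. p \<in> Q - {C} \<Longrightarrow> q \<in> Q - {C} \<Longrightarrow> p \<noteq> q \<Longrightarrow> disjnt p q"
        using Q unfolding partition_on_def disjoint_def disjnt_def by blast
      show "{} \<notin> Q - {C}" using ne by blast
    qed
    moreover have "Q = insert {a} (Q - {C})" using C True by auto
    ultimately show thesis using that(1) by blast
  next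
    case False
    define B where "B = C - {a}"
    have Bne: "B \<noteq> {}" using False C B_def by auto
    have CB: "C = insert a B" using C B_def by auto
    have BQ: "B \<notin> Q" using uniq[of B] Bne B_def C by auto
    have "partition_on A (insert B (Q - {C}))"
    proof (rule partition_onI)
      show "\<Union>(insert B (Q - {C})) = A"
      proof -
        have "\<Union>(insert B (Q - {C})) = \<Union>Q - {a}"
          using C uniq B_def by blast
        then show ?thesis using un a by auto
      qed
      show "\<And>p q. p \<in> insert B (Q - {C}) \<Longrightarrow> q \<in> insert B (Q - {C}) \<Longrightarrow> p \<noteq> q \<Longrightarrow> disjnt p q"
        using Q uniq B_def unfolding partition_on_def disjoint_def disjnt_def by blast
      show "{} \<notin> insert B (Q - {C})" using ne Bne by blast
    qed
    moreover have "Q = insert (insert a B) (insert B (Q - {C}) - {B})"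
      using C CB BQ by auto
    ultimately show thesis using that(2)[of "insert B (Q - {C})" B] by blast
  qed
qed

text \<open>Both ways of inserting \<open>a\<close> are injective and their images are disjoint:
  \<open>a\<close> lies in no old block, so the enlarged partition reveals where it went.\<close>

lemma sum_partition_on_insert:
  fixes f :: "'a set set \<Rightarrow> 'b::comm_monoid_add"
  assumes "finite A" and a: "a \<notin> A"
  shows "(\<Sum>Q | partition_on (insert a A) Q. f Q) =
    (\<Sum>P | partition_on A P. f (insert {a} P) + (\<Sum>B\<in>P. f (insert (insert a B) (P - {B}))))"
proof -
  let ?\<Pi> = "{P. partition_on A P}"
  let ?g = "\<lambda>P. insert {a} P" and ?h = "\<lambda>(P, B). insert (insert a B) (P - {B})"
  have fin: "finite ?\<Pi>" using finitely_many_partition_on[OF \<open>finite A\<close>] .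
  have finP: "\<And>P. P \<in> ?\<Pi> \<Longrightarrow> finite P" using finite_elements[OF \<open>finite A\<close>] by blast
  have na: "\<And>P B. P \<in> ?\<Pi> \<Longrightarrow> B \<in> P \<Longrightarrow> a \<notin> B"
    using a unfolding partition_on_def by blast
  have ne: "\<And>P. P \<in> ?\<Pi> \<Longrightarrow> {} \<notin> P" unfolding partition_on_def by blast
  have eq: "{Q. partition_on (insert a A) Q} = ?g ` ?\<Pi> \<union> ?h ` Sigma ?\<Pi> (\<lambda>P. P)"
  proof (intro equalityI subsetI)
    fix Q assume "Q \<in> {Q. partition_on (insert a A) Q}"
    then show "Q \<in> ?g ` ?\<Pi> \<union> ?h ` Sigma ?\<Pi> (\<lambda>P. P)"
    proof (rule CollectE)
      assume "partition_on (insert a A) Q"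
      then show ?thesis
      proof (cases rule: partition_on_insert_cases[OF _ a, consumes 1, case_names new old])
        case (new P)
        then show ?thesis by simp
      next
        case (old P B)
        then have "(P, B) \<in> Sigma ?\<Pi> (\<lambda>P. P)" "Q = ?h (P, B)" by simp_all
        then show ?thesis by (intro UnI2 image_eqI)
      qed
    qed
  qed (use a in \<open>auto intro: partition_on_insert_singleton partition_on_insert_into_block\<close>)
  have disj: "?g ` ?\<Pi> \<inter> ?h ` Sigma ?\<Pi> (\<lambda>P. P) = {}"
  proof -
    have *: False if "P \<in> ?\<Pi>" "P' \<in> ?\<Pi>" "B \<in> P'" and e: "insert {a} P = insert (insert a B) (P' - {B})" for P P' B
    proof -
      have "{a} \<in> insert (insert a B) (P' - {B})" unfolding e[symmetric] by blast
      moreover have "B \<noteq> {}" using ne[OF that(2)] that(3) by blast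
      then have "{a} \<noteq> insert a B" using na[OF that(2,3)] by blast
      moreover have "{a} \<notin> P'" using na[OF that(2)] by blast
      ultimately show False by blast
    qed
    have "?g P \<noteq> ?h X" if P: "P \<in> ?\<Pi>" and X: "X \<in> Sigma ?\<Pi> (\<lambda>P. P)" for P X
    proof -
      obtain P' B where X': "X = (P', B)" "P' \<in> ?\<Pi>" "B \<in> P'" using X by (rule SigmaE)
      show ?thesis unfolding X'(1) case_prod_conv by (rule notI) (rule *[OF P X'(2,3)])
    qed
    then show ?thesis by (intro equals0I) (erule IntE, elim imageE, simp only:)
  qed
  have injg: "inj_on ?g ?\<Pi>"
  proof (rule inj_onI)
    fix P P' assume "P \<in> ?\<Pi>" "P' \<in> ?\<Pi>" "insert {a} P = insert {a} P'"
    moreover have "{a} \<notin> P" "{a} \<notin> P'" using na calculation by blast+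
    ultimately show "P = P'" by (simp add: insert_ident)
  qed
  have injh: "inj_on ?h (Sigma ?\<Pi> (\<lambda>P. P))"
  proof (rule inj_onI, clarify, rule conjI)
    fix P B P' B'
    assume P: "partition_on A P" "B \<in> P" and P': "partition_on A P'" "B' \<in> P'"
      and e: "insert (insert a B) (P - {B}) = insert (insert a B') (P' - {B'})"
    have n: "\<And>E. E \<in> P \<Longrightarrow> a \<notin> E" "\<And>E. E \<in> P' \<Longrightarrow> a \<notin> E"
      using na P P' by blast+
    have "insert a B \<in> insert (insert a B') (P' - {B'})" unfolding e[symmetric] by blast
    then have "insert a B = insert a B'" using n by blast
    then show BB: "B = B'" using n P P' by (meson insert_ident)
    have "insert a B \<notin> P - {B}" "insert a B \<notin> P' - {B}" using n by blast+
    then have "P - {B} = P' - {B}" using e BB by (metis insert_ident)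
    then show "P = P'" using P P' BB by blast
  qed
  have "(\<Sum>Q | partition_on (insert a A) Q. f Q) = sum f (?g ` ?\<Pi>) + sum f (?h ` Sigma ?\<Pi> (\<lambda>P. P))"
    unfolding eq using fin finP disj by (intro sum.union_disjoint) auto
  also have "sum f (?g ` ?\<Pi>) = (\<Sum>P\<in>?\<Pi>. f (insert {a} P))"
    using injg by (simp add: sum.reindex)
  also have "sum f (?h ` Sigma ?\<Pi> (\<lambda>P. P)) = (\<Sum>(P, B)\<in>Sigma ?\<Pi> (\<lambda>P. P). f (insert (insert a B) (P - {B})))"
    by (subst sum.reindex[OF injh]) (simp add: o_def split_beta)
  also have "\<dots> = (\<Sum>P\<in>?\<Pi>. \<Sum>B\<in>P. f (insert (insert a B) (P - {B})))"
    using fin finP by (simp add: sum.Sigma)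
  finally show ?thesis by (simp add: sum.distrib)
qed

lemma sum_Pow_insert:
  assumes "finite A" "a \<notin> A"
  shows "(\<Sum>S\<in>Pow (insert a A). f S) = (\<Sum>S\<in>Pow A. f S + f (insert a S))"
proof -
  have inj: "inj_on (insert a) (Pow A)" using assms(2) by (intro inj_onI) (metis PowD insert_ident subsetD)
  have "(\<Sum>S\<in>Pow (insert a A). f S) = sum f (Pow A) + sum f (insert a ` Pow A)"
    unfolding Pow_insert using assms by (intro sum.union_disjoint) auto
  also have "sum f (insert a ` Pow A) = (\<Sum>S\<in>Pow A. f (insert a S))"
    using inj by (simp add: sum.reindex)
  finally show ?thesis by (simp add: sum.distrib)
qed

text \<open>Double counting of sets with a marked element. Later the sets are the open blocks and
  the mark is the block that gets extended.\<close>

lemma sum_Pow_elements: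
  assumes "finite A"
  shows "(\<Sum>S\<in>Pow A. \<Sum>a\<in>S. f a S) = (\<Sum>a\<in>A. \<Sum>S\<in>Pow (A - {a}). f a (insert a S))"
proof -
  have "(\<Sum>S\<in>Pow A. \<Sum>a\<in>S. f a S) = (\<Sum>S\<in>Pow A. \<Sum>a\<in>A. if a \<in> S then f a S else 0)"
    using assms by (intro sum.cong[OF refl]) (simp only: sum.inter_restrict[symmetric] Int_absorb1 Pow_iff)
  also have "\<dots> = (\<Sum>a\<in>A. \<Sum>S\<in>Pow A. if a \<in> S then f a S else 0)" by (rule sum.swap)
  also have "\<dots> = (\<Sum>a\<in>A. \<Sum>S\<in>Pow (A - {a}). f a (insert a S))"
  proof (rule sum.cong[OF refl])
    fix a assume "a \<in> A"
    then have "insert a (A - {a}) = A" by blast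
    then have "(\<Sum>S\<in>Pow A. if a \<in> S then f a S else 0) =
      (\<Sum>S\<in>Pow (A - {a}). (if a \<in> S then f a S else 0) + (if a \<in> insert a S then f a (insert a S) else 0))"
      using sum_Pow_insert[of "A - {a}" a "\<lambda>S. if a \<in> S then f a S else 0"] assms by simp
    also have "\<dots> = (\<Sum>S\<in>Pow (A - {a}). f a (insert a S))"
      by (intro sum.cong) auto
    finally show "(\<Sum>S\<in>Pow A. if a \<in> S then f a S else 0) = \<dots>" .
  qed
  finally show ?thesis .
qed

section \<open>Open blocks and the transfer rule for one new element\<close>

text \<open>\<open>open_dim n \<pi> S\<close> is the dimension exponent of \<open>\<pi>\<close> when the blocks in \<open>S\<close> count as reaching up to \<open>n\<close>
  because they will receive further elements.\<close>

definition open_dim :: "nat \<Rightarrow> nat set set \<Rightarrow> nat set set \<Rightarrow> int" where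
  "open_dim n \<pi> S = (\<Sum>B\<in>\<pi>. (if B \<in> S then int n else int (Max B)) - int (Min B) + 1) - int n"

text \<open>A weight sees a state only through its exponent and its number of open blocks; leaving
  \<open>g\<close> arbitrary covers scalar and polynomial weights alike.\<close>

definition open_sum :: "nat \<Rightarrow> (int \<Rightarrow> nat \<Rightarrow> 'a::comm_monoid_add) \<Rightarrow> 'a" where
  "open_sum n g = (\<Sum>\<pi>\<in>set_partitions n. \<Sum>S\<in>Pow \<pi>. g (open_dim n \<pi> S) (card S))"

lemma set_partitionsD:
  assumes "\<pi> \<in> set_partitions n"
  shows "finite \<pi>" and "\<And>B. B \<in> \<pi> \<Longrightarrow> B \<noteq> {} \<and> B \<subseteq> {1..n}"
  using assms finite_elements[of "{1..n}" \<pi>] unfolding set_partitions_def partition_on_def by auto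

lemma sum_open_time:
  assumes "finite P" "S \<subseteq> P"
  shows "(\<Sum>B\<in>P. (if B \<in> S then int (Suc n) else f B) - g B + 1) =
    (\<Sum>B\<in>P. (if B \<in> S then int n else f B) - g B + 1) + int (card S)"
proof -
  have "(\<Sum>B\<in>P. (if B \<in> S then int (Suc n) else f B) - g B + 1) =
    (\<Sum>B\<in>P. ((if B \<in> S then int n else f B) - g B + 1) + (if B \<in> S then 1 else 0))"
    by (intro sum.cong) auto
  also have "\<dots> = (\<Sum>B\<in>P. (if B \<in> S then int n else f B) - g B + 1) + (\<Sum>B\<in>P. if B \<in> S then 1 else 0)"
    by (rule sum.distrib)
  also have "(\<Sum>B\<in>P. if B \<in> S then 1 else 0) = int (card S)"
    using assms by (simp add: sum.If_cases Int_absorb1)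
  finally show ?thesis .
qed

text \<open>The new singleton contributes 1, which cancels against the growth of the subtracted
  size, so only the stretching of the old open blocks remains. Declaring the new block open changes
  nothing because its maximum is already \<open>Suc n\<close>.\<close>

lemma open_dim_new_block:
  assumes \<pi>: "\<pi> \<in> set_partitions n" and S: "S \<subseteq> \<pi>"
  shows "open_dim (Suc n) (insert {Suc n} \<pi>) S = open_dim n \<pi> S + int (card S)"
    and "open_dim (Suc n) (insert {Suc n} \<pi>) (insert {Suc n} S) = open_dim n \<pi> S + int (card S)"
proof -
  have new: "{Suc n} \<notin> \<pi>" using set_partitionsD(2)[OF \<pi>, of "{Suc n}"] by auto
  have "(\<Sum>B\<in>\<pi>. (if B = {Suc n} \<or> B \<in> S then int (Suc n) else int (Max B)) - int (Min B) + 1) =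
    (\<Sum>B\<in>\<pi>. (if B \<in> S then int (Suc n) else int (Max B)) - int (Min B) + 1)"
    using new by (intro sum.cong) auto
  with new S show "open_dim (Suc n) (insert {Suc n} \<pi>) S = open_dim n \<pi> S + int (card S)"
    "open_dim (Suc n) (insert {Suc n} \<pi>) (insert {Suc n} S) = open_dim n \<pi> S + int (card S)"
    using sum_open_time[OF set_partitionsD(1)[OF \<pi>] S, of n "\<lambda>B. int (Max B)" "\<lambda>B. int (Min B)"]
      set_partitionsD(1)[OF \<pi>]
    by (auto simp: open_dim_def)
qed

text \<open>The block \<open>B\<close> has to be open beforehand. Its stretching by one cancels
  against the growth of the subtracted size, so only the other open blocks contribute.\<close>

lemma open_dim_extend_block:
  assumes \<pi>: "\<pi> \<in> set_partitions n" and B: "B \<in> \<pi>" and S: "S \<subseteq> \<pi> - {B}"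
  shows "open_dim (Suc n) (insert (insert (Suc n) B) (\<pi> - {B})) S = open_dim n \<pi> (insert B S) + int (card S)"
    and "open_dim (Suc n) (insert (insert (Suc n) B) (\<pi> - {B})) (insert (insert (Suc n) B) S) =
      open_dim n \<pi> (insert B S) + int (card S)"
proof -
  let ?C = "insert (Suc n) B"
  have new: "?C \<notin> \<pi>" using set_partitionsD(2)[OF \<pi>, of ?C] by auto
  have fin: "finite \<pi>" "finite (\<pi> - {B})" using set_partitionsD(1)[OF \<pi>] by auto
  have Bn: "B \<noteq> {}" "B \<subseteq> {1..n}" "finite B"
    using set_partitionsD(2)[OF \<pi> B] finite_subset by auto
  then have m: "Max ?C = Suc n" "Min ?C = Min B"
  proof -
    have "\<And>x. x \<in> B \<Longrightarrow> x \<le> n" using Bn by auto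
    then show "Max ?C = Suc n" using Bn by (auto intro!: Max_eqI simp: le_SucI)
    have "Min B \<in> B" using Bn by simp
    then have "Min B \<le> n" using Bn(2) by (meson atLeastAtMost_iff subsetD)
    then show "Min ?C = Min B" using Bn by simp
  qed
  have C: "?C \<notin> S" using new S by auto
  have 1: "(\<Sum>E\<in>\<pi> - {B}. (if E = ?C \<or> E \<in> S then int (Suc n) else int (Max E)) - int (Min E) + 1) =
    (\<Sum>E\<in>\<pi> - {B}. (if E \<in> S then int (Suc n) else int (Max E)) - int (Min E) + 1)"
    using new by (intro sum.cong) auto
  have "(\<Sum>E\<in>\<pi>. (if E \<in> insert B S then int n else int (Max E)) - int (Min E) + 1) =
    (int n - int (Min B) + 1) + (\<Sum>E\<in>\<pi> - {B}. (if E \<in> insert B S then int n else int (Max E)) - int (Min E) + 1)"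
    by (subst sum.remove[OF fin(1) B]) simp
  also have "(\<Sum>E\<in>\<pi> - {B}. (if E \<in> insert B S then int n else int (Max E)) - int (Min E) + 1) =
    (\<Sum>E\<in>\<pi> - {B}. (if E \<in> S then int n else int (Max E)) - int (Min E) + 1)"
    by (intro sum.cong) auto
  finally have 2: "open_dim n \<pi> (insert B S) = (int n - int (Min B) + 1) +
     (\<Sum>E\<in>\<pi> - {B}. (if E \<in> S then int n else int (Max E)) - int (Min E) + 1) - int n"
    unfolding open_dim_def by simp
  show "open_dim (Suc n) (insert ?C (\<pi> - {B})) S = open_dim n \<pi> (insert B S) + int (card S)"
    unfolding 2 using sum_open_time[OF fin(2) S, of n "\<lambda>B. int (Max B)" "\<lambda>B. int (Min B)"]
      new C fin m by (simp add: open_dim_def)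
  show "open_dim (Suc n) (insert ?C (\<pi> - {B})) (insert ?C S) = open_dim n \<pi> (insert B S) + int (card S)"
    unfolding 2 using sum_open_time[OF fin(2) S, of n "\<lambda>B. int (Max B)" "\<lambda>B. int (Min B)"]
      new C fin m 1 by (simp add: open_dim_def)
qed

lemma open_sum_0: "open_sum 0 g = g 0 0"
proof -
  have "set_partitions 0 = {{}}" unfolding set_partitions_def by (auto simp: partition_on_def)
  then show ?thesis by (simp add: open_sum_def open_dim_def)
qed

text \<open>The new element starts a block that is closed at once or left open, or it continues one
  of the \<open>m\<close> open blocks and closes it or leaves it open. The truncation in
  \<open>m - 1\<close> is harmless, as the factor \<open>of_nat m\<close> vanishes at 0.\<close>

lemma open_sum_Suc:
  fixes g :: "int \<Rightarrow> nat \<Rightarrow> 'a::semiring_1"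
  shows "open_sum (Suc n) g = open_sum n (\<lambda>d m.
    g (d + int m) m + g (d + int m) (Suc m) +
    of_nat m * (g (d + int m - 1) (m - 1) + g (d + int m - 1) m))"
proof -
  let ?F = "\<lambda>\<pi>. \<Sum>S\<in>Pow \<pi>. g (open_dim (Suc n) \<pi> S) (card S)"
  have ins: "{1..Suc n} = insert (Suc n) {1..n}" by auto
  have "open_sum (Suc n) g = (\<Sum>\<pi>\<in>set_partitions n.
     ?F (insert {Suc n} \<pi>) + (\<Sum>B\<in>\<pi>. ?F (insert (insert (Suc n) B) (\<pi> - {B}))))"
    unfolding open_sum_def set_partitions_def ins by (rule sum_partition_on_insert) auto
  also have "\<dots> = open_sum n (\<lambda>d m.
    g (d + int m) m + g (d + int m) (Suc m) +
    of_nat m * (g (d + int m - 1) (m - 1) + g (d + int m - 1) m))"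
    unfolding open_sum_def
  proof (rule sum.cong[OF refl])
    fix \<pi> assume \<pi>: "\<pi> \<in> set_partitions n"
    note fin = set_partitionsD(1)[OF \<pi>]
    have fS: "\<And>S. S \<subseteq> \<pi> \<Longrightarrow> finite S" using fin finite_subset by blast
    have new: "{Suc n} \<notin> \<pi>" "\<And>B. insert (Suc n) B \<notin> \<pi>"
      using set_partitionsD(2)[OF \<pi>] by fastforce+
    let ?d = "open_dim n \<pi>"
    have 1: "?F (insert {Suc n} \<pi>) = (\<Sum>S\<in>Pow \<pi>. g (?d S + int (card S)) (card S) + g (?d S + int (card S)) (Suc (card S)))"
      unfolding sum_Pow_insert[OF fin new(1)]
    proof (rule sum.cong[OF refl])
      fix S assume "S \<in> Pow \<pi>"
      then have S: "S \<subseteq> \<pi>" by simp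
      moreover have "card (insert {Suc n} S) = Suc (card S)" using S fS[OF S] new by (subst card_insert_disjoint) auto
      ultimately show "g (open_dim (Suc n) (insert {Suc n} \<pi>) S) (card S) +
         g (open_dim (Suc n) (insert {Suc n} \<pi>) (insert {Suc n} S)) (card (insert {Suc n} S)) =
         g (?d S + int (card S)) (card S) + g (?d S + int (card S)) (Suc (card S))"
        using open_dim_new_block[OF \<pi> S] by simp
    qed
    \<comment> \<open>Everything is expressed through \<open>insert B S\<close>, the open set before
      the step, so that \<open>sum_Pow_elements\<close> can be applied from right to left.\<close>
    have 2: "(\<Sum>B\<in>\<pi>. ?F (insert (insert (Suc n) B) (\<pi> - {B}))) =
      (\<Sum>B\<in>\<pi>. \<Sum>S\<in>Pow (\<pi> - {B}). g (?d (insert B S) + int (card (insert B S)) - 1) (card (insert B S) - 1)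
         + g (?d (insert B S) + int (card (insert B S)) - 1) (card (insert B S)))"
    proof (rule sum.cong[OF refl])
      fix B assume B: "B \<in> \<pi>"
      have f: "finite (\<pi> - {B})" "insert (Suc n) B \<notin> \<pi> - {B}" using fin new by auto
      show "?F (insert (insert (Suc n) B) (\<pi> - {B})) =
        (\<Sum>S\<in>Pow (\<pi> - {B}). g (?d (insert B S) + int (card (insert B S)) - 1) (card (insert B S) - 1)
         + g (?d (insert B S) + int (card (insert B S)) - 1) (card (insert B S)))"
        unfolding sum_Pow_insert[OF f]
      proof (rule sum.cong[OF refl])
        fix S assume "S \<in> Pow (\<pi> - {B})"
        then have S: "S \<subseteq> \<pi> - {B}" by simp
        moreover have "card (insert B S) = Suc (card S)" using S fS[of S] by (subst card_insert_disjoint) auto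
        moreover have "card (insert (insert (Suc n) B) S) = Suc (card S)"
          using S fS[of S] new by (subst card_insert_disjoint) auto
        ultimately show "g (open_dim (Suc n) (insert (insert (Suc n) B) (\<pi> - {B})) S) (card S) +
          g (open_dim (Suc n) (insert (insert (Suc n) B) (\<pi> - {B})) (insert (insert (Suc n) B) S)) (card (insert (insert (Suc n) B) S)) =
          g (?d (insert B S) + int (card (insert B S)) - 1) (card (insert B S) - 1) +
          g (?d (insert B S) + int (card (insert B S)) - 1) (card (insert B S))"
          using open_dim_extend_block[OF \<pi> B S] by simp
      qed
    qed
    also have "\<dots> = (\<Sum>S\<in>Pow \<pi>. \<Sum>B\<in>S. g (?d S + int (card S) - 1) (card S - 1) + g (?d S + int (card S) - 1) (card S))"
      by (rule sum_Pow_elements[OF fin, symmetric])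
    finally show "?F (insert {Suc n} \<pi>) + (\<Sum>B\<in>\<pi>. ?F (insert (insert (Suc n) B) (\<pi> - {B}))) =
      (\<Sum>S\<in>Pow \<pi>. g (?d S + int (card S)) (card S) + g (?d S + int (card S)) (Suc (card S)) +
        of_nat (card S) * (g (?d S + int (card S) - 1) (card S - 1) + g (?d S + int (card S) - 1) (card S)))"
      unfolding 1 by (simp add: sum.distrib algebra_simps)
  qed
  finally show ?thesis .
qed

text \<open>At the end no block may still await elements, so only the empty set of open blocks
  counts.\<close>

lemma dim_moment_open_sum:
  "dim_moment k n = open_sum n (\<lambda>d m. if m = 0 then d ^ k else 0)"
  unfolding dim_moment_def open_sum_def
proof (rule sum.cong[OF refl])
  fix \<pi> assume \<pi>: "\<pi> \<in> set_partitions n"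
  note fin = set_partitionsD(1)[OF \<pi>]
  have "(\<Sum>S\<in>Pow \<pi>. if card S = 0 then open_dim n \<pi> S ^ k else 0) =
    (\<Sum>S\<in>Pow \<pi>. if S = {} then open_dim n \<pi> S ^ k else 0)"
    using fin by (intro sum.cong) (auto simp: finite_subset)
  also have "\<dots> = open_dim n \<pi> {} ^ k" using fin by (simp add: sum.delta)
  also have "open_dim n \<pi> {} = dim_exponent n \<pi>" by (simp add: open_dim_def dim_exponent_def)
  finally show "dim_exponent n \<pi> ^ k = (\<Sum>S\<in>Pow \<pi>. if card S = 0 then open_dim n \<pi> S ^ k else 0)" by simp
qed

section \<open>The Bell functional and Charlier polynomials\<close>

definition \<xi> :: "rat poly" where
  "\<xi> = [:0, 1:]"

lemma poly_\<xi> [simp]: "poly \<xi> x = x"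
  by (simp add: \<xi>_def)

lemma degree_\<xi> [simp]: "degree \<xi> = 1"
  by (simp add: \<xi>_def)

text \<open>\<open>raising\<close> and \<open>shifting\<close> are \<open>Y\<close> and
  \<open>D\<close> of the overview; the variable \<open>v\<close> there is \<open>\<xi>\<close>
  here.\<close>

definition raising :: "rat poly \<Rightarrow> rat poly" where
  "raising f = \<xi> * pcompose f [:-1, 1:]"

definition shifting :: "rat poly \<Rightarrow> rat poly" where
  "shifting f = pcompose f [:1, 1:]"

lemma poly_raising: "poly (raising f) x = x * poly f (x - 1)"
  by (simp add: raising_def poly_pcompose)

lemma poly_shifting: "poly (shifting f) x = poly f (x + 1)"
  by (simp add: shifting_def poly_pcompose add.commute)

text \<open>A polynomial over an infinite field is determined by its values, which reduces operator
  identities to evaluation at a point.\<close>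

lemma rat_poly_eqI: "(\<And>x. poly f x = poly g x) \<Longrightarrow> f = (g :: rat poly)"
  by (simp add: poly_eq_poly_eq_iff[symmetric] fun_eq_iff)

lemma raising_add: "raising (f + g) = raising f + raising g"
  and raising_diff: "raising (f - g) = raising f - raising g"
  and raising_smult: "raising (smult c f) = smult c (raising f)"
  and raising_0 [simp]: "raising 0 = 0"
  by (simp_all add: raising_def pcompose_add pcompose_diff pcompose_smult algebra_simps)

lemma shifting_add: "shifting (f + g) = shifting f + shifting g"
  and shifting_diff: "shifting (f - g) = shifting f - shifting g"
  and shifting_smult: "shifting (smult c f) = smult c (shifting f)"
  and shifting_0 [simp]: "shifting 0 = 0"
  by (simp_all add: shifting_def pcompose_add pcompose_diff pcompose_smult)

text \<open>The commutation relation \<open>D Y - Y D = 1\<close>, on which the difference calculus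
  and the Charlier identities rest.\<close>

lemma shifting_raising: "shifting (raising f) = raising (shifting f) + f"
  by (rule rat_poly_eqI) (simp add: poly_shifting poly_raising algebra_simps)

lemma raising_shifting: "raising (shifting f) = \<xi> * f"
  by (rule rat_poly_eqI) (simp add: poly_shifting poly_raising)

definition fwd_diff :: "rat poly \<Rightarrow> rat poly" where
  "fwd_diff f = shifting f - f"

lemma shifting_1 [simp]: "shifting 1 = 1"
  by (simp add: shifting_def pcompose_1)

lemma raising_1 [simp]: "raising 1 = \<xi>"
  by (simp add: raising_def pcompose_1)

lemma fwd_diff_add: "fwd_diff (f + g) = fwd_diff f + fwd_diff g"
  and fwd_diff_smult: "fwd_diff (smult c f) = smult c (fwd_diff f)"
  and fwd_diff_0 [simp]: "fwd_diff 0 = 0"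
  by (simp_all add: fwd_diff_def shifting_add shifting_smult smult_diff_right)

lemma degree_fwd_diff:
  assumes "fwd_diff f \<noteq> 0"
  shows "degree (fwd_diff f) < degree f"
proof -
  have d: "degree (shifting f) = degree f" by (simp add: shifting_def degree_pcompose)
  have "lead_coeff (shifting f) = lead_coeff f"
    unfolding shifting_def by (subst lead_coeff_comp) auto
  then have c: "coeff (fwd_diff f) (degree f) = 0" using d by (simp add: fwd_diff_def)
  have "degree (fwd_diff f) \<le> degree f" unfolding fwd_diff_def using d by (metis degree_diff_le order_refl)
  then show ?thesis using c assms by (metis le_neq_implies_less leading_coeff_0_iff)
qed

lemma fwd_diff_funpow_eq_0: "degree f < i \<Longrightarrow> (fwd_diff ^^ i) f = 0"
proof (induction i arbitrary: f)
  case (Suc i)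
  show ?case
  proof (cases "fwd_diff f = 0")
    case True
    then show ?thesis by (simp add: funpow_Suc_right del: funpow.simps) (induction i; simp)
  next
    case False
    then show ?thesis using Suc degree_fwd_diff[of f] by (simp add: funpow_Suc_right del: funpow.simps)
  qed
qed simp

lemma fwd_diff_funpow_add: "(fwd_diff ^^ i) (f + g) = (fwd_diff ^^ i) f + (fwd_diff ^^ i) g"
  by (induction i) (simp_all add: fwd_diff_add)

lemma fwd_diff_funpow_smult: "(fwd_diff ^^ i) (smult c f) = smult c ((fwd_diff ^^ i) f)"
  by (induction i) (simp_all add: fwd_diff_smult)

lemma fwd_diff_raising: "fwd_diff (raising f) = raising (fwd_diff f) + f"
  by (simp add: fwd_diff_def shifting_raising raising_diff)

text \<open>Since \<open>fwd_diff\<close> and \<open>raising\<close> have commutator 1, this is the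
  analogue of the Leibniz rule for derivatives of \<open>x * f\<close>.\<close>

lemma fwd_diff_funpow_raising: "(fwd_diff ^^ Suc i) (raising f) = raising ((fwd_diff ^^ Suc i) f) + of_nat (Suc i) * (fwd_diff ^^ i) f"
proof (induction i)
  case (Suc i)
  have "(fwd_diff ^^ Suc (Suc i)) (raising f) = fwd_diff (raising ((fwd_diff ^^ Suc i) f) + of_nat (Suc i) * (fwd_diff ^^ i) f)"
    using Suc by simp
  also have "of_nat (Suc i) * (fwd_diff ^^ i) f = smult (of_nat (Suc i)) ((fwd_diff ^^ i) f)"
    by (simp add: of_nat_poly)
  also have "fwd_diff (raising ((fwd_diff ^^ Suc i) f) + smult (of_nat (Suc i)) ((fwd_diff ^^ i) f)) =
    raising ((fwd_diff ^^ Suc (Suc i)) f) + (fwd_diff ^^ Suc i) f + smult (of_nat (Suc i)) ((fwd_diff ^^ Suc i) f)"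
    by (simp add: fwd_diff_add fwd_diff_smult fwd_diff_raising)
  also have "\<dots> = raising ((fwd_diff ^^ Suc (Suc i)) f) + smult (of_nat (Suc (Suc i))) ((fwd_diff ^^ Suc i) f)"
    unfolding of_nat_Suc[of "Suc i"] smult_add_left by simp
  finally show ?case by (simp add: of_nat_poly)
qed (simp add: fwd_diff_raising)

section \<open>The linear functional L\<close>

text \<open>Newton's forward difference formula expands \<open>f\<close> in falling factorials; \<open>bell_functional\<close> sends each of
  them to \<open>1\<close>.\<close>

definition bell_functional :: "rat poly \<Rightarrow> rat" where
  "bell_functional f = (\<Sum>i\<le>degree f. poly ((fwd_diff ^^ i) f) 0 / fact i)"

text \<open>Differences beyond the degree vanish, so several polynomials can share one cut-off
  \<open>N\<close>; this makes linearity visible.\<close>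

lemma bell_functional_eq: "degree f \<le> N \<Longrightarrow> bell_functional f = (\<Sum>i\<le>N. poly ((fwd_diff ^^ i) f) 0 / fact i)"
  unfolding bell_functional_def by (intro sum.mono_neutral_left) (auto simp: fwd_diff_funpow_eq_0)

lemma bell_functional_add: "bell_functional (f + g) = bell_functional f + bell_functional g"
proof -
  define N where "N = max (degree f) (degree g)"
  have "degree f \<le> N" "degree g \<le> N" "degree (f + g) \<le> N"
    by (simp_all add: N_def degree_add_le_max)
  then show ?thesis
    by (simp add: bell_functional_eq[of _ N] fwd_diff_funpow_add add_divide_distrib sum.distrib)
qed

lemma bell_functional_smult: "bell_functional (smult c f) = c * bell_functional f"
proof -
  have "degree (smult c f) \<le> degree f" by simp
  then show ?thesis
    by (simp add: bell_functional_eq[of _ "degree f"] fwd_diff_funpow_smult sum_distrib_left)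
qed

lemma bell_functional_0 [simp]: "bell_functional 0 = 0" by (simp add: bell_functional_def)
lemma bell_functional_1: "bell_functional 1 = 1" by (simp add: bell_functional_def)

lemma bell_functional_diff: "bell_functional (f - g) = bell_functional f - bell_functional g"
  using bell_functional_add[of "f - g" g] by simp

lemma bell_functional_sum: "bell_functional (\<Sum>i\<in>I. f i) = (\<Sum>i\<in>I. bell_functional (f i))"
  by (induction I rule: infinite_finite_induct) (simp_all add: bell_functional_add)

lemma degree_raising: "degree (raising f) \<le> Suc (degree f)"
proof -
  have "degree (raising f) \<le> degree \<xi> + degree (pcompose f [:-1, 1:])"
    unfolding raising_def by (rule degree_mult_le)
  then show ?thesis by (simp add: degree_pcompose)
qed

text \<open>The \<open>raising\<close> part of \<open>fwd_diff_funpow_raising\<close> vanishes at 0,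
  and the factor \<open>Suc i\<close> is absorbed by the factorial.\<close>

lemma bell_functional_raising: "bell_functional (raising f) = bell_functional f"
proof -
  have "bell_functional (raising f) = (\<Sum>i\<le>Suc (degree f). poly ((fwd_diff ^^ i) (raising f)) 0 / fact i)"
    by (rule bell_functional_eq[OF degree_raising])
  also have "\<dots> = poly (raising f) 0 + (\<Sum>i\<le>degree f. poly ((fwd_diff ^^ Suc i) (raising f)) 0 / fact (Suc i))"
    by (simp only: sum.atMost_Suc_shift) simp
  also have "\<dots> = (\<Sum>i\<le>degree f. of_nat (Suc i) * poly ((fwd_diff ^^ i) f) 0 / fact (Suc i))"
    unfolding fwd_diff_funpow_raising by (simp add: poly_raising del: of_nat_Suc)
  also have "\<dots> = bell_functional f"
    unfolding bell_functional_def by (intro sum.cong refl) (simp del: of_nat_Suc)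
  finally show ?thesis .
qed

lemma bell_functional_shifting: "bell_functional (shifting f) = bell_functional (\<xi> * f)"
  using bell_functional_raising[of "shifting f"] by (simp add: raising_shifting)

section \<open>Charlier polynomials and the operator Z\<close>

text \<open>The monic Charlier polynomials with parameter 1, generated by applying powers of
  \<open>Y - 1\<close> to 1.\<close>

fun charlier :: "nat \<Rightarrow> rat poly" where
  "charlier 0 = 1"
| "charlier (Suc m) = raising (charlier m) - charlier m"

text \<open>The functional kills the image of \<open>Y - 1\<close>, so with Charlier weights it
  selects the states without open blocks.\<close>

lemma bell_functional_charlier: "bell_functional (charlier m) = (if m = 0 then 1 else 0)"
  by (cases m) (simp_all add: bell_functional_1 bell_functional_diff bell_functional_raising)

text \<open>Equivalently, \<open>D - 1\<close> lowers the index with factor \<open>m\<close>, as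
  differentiation does for powers; the commutation relation drives the induction.\<close>

lemma shifting_charlier: "shifting (charlier m) = charlier m + smult (of_nat m) (charlier (m - 1))"
proof (induction m)
  case 0
  then show ?case by (simp add: shifting_def pcompose_1)
next
  case (Suc m)
  show ?case
  proof (cases m)
    case 0
    then show ?thesis by (simp add: shifting_diff) (simp add: \<xi>_def shifting_def pcompose_pCons one_pCons)
  next
    case (Suc l)
    have "shifting (charlier (Suc m)) = raising (shifting (charlier m)) + charlier m - shifting (charlier m)"
      by (simp add: shifting_diff shifting_raising)
    also have "\<dots> = charlier (Suc m) + charlier m + smult (of_nat m) (raising (charlier l) - charlier l)"
      unfolding Suc.IH using Suc by (simp add: raising_add raising_smult smult_diff_right)
    also have "raising (charlier l) - charlier l = charlier m" using Suc by simp
    finally show ?thesis by (simp add: smult_add_left)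
  qed
qed

text \<open>The operator \<open>Z = (Y - 1) (D - 1)\<close> multiplied out, with multiplication by
  \<open>\<xi>\<close> in place of \<open>Y D\<close>. Its eigenvalues are the numbers of open
  blocks.\<close>

definition number_op :: "rat poly \<Rightarrow> rat poly" where
  "number_op f = \<xi> * f - raising f - shifting f + f"

lemma number_op_alt: "number_op f = raising (shifting f - f) - (shifting f - f)"
  by (simp add: number_op_def raising_diff raising_shifting)

lemma number_op_add: "number_op (f + g) = number_op f + number_op g"
  and number_op_smult: "number_op (smult c f) = smult c (number_op f)"
  and number_op_0 [simp]: "number_op 0 = 0"
  by (simp_all add: number_op_def raising_add raising_smult shifting_add shifting_smult algebra_simps smult_add_right smult_diff_right)

lemma number_op_charlier: "number_op (charlier m) = smult (of_nat m) (charlier m)"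
proof (cases m)
  case (Suc l)
  then show ?thesis unfolding number_op_alt shifting_charlier
    by (simp add: raising_smult smult_diff_right)
qed (simp add: number_op_alt shifting_charlier)

lemma number_op_funpow_add: "(number_op ^^ j) (f + g) = (number_op ^^ j) f + (number_op ^^ j) g"
  by (induction j) (simp_all add: number_op_add)

lemma number_op_funpow_smult: "(number_op ^^ j) (smult c f) = smult c ((number_op ^^ j) f)"
  by (induction j) (simp_all add: number_op_smult)

lemma number_op_funpow_charlier: "(number_op ^^ j) (charlier m) = smult (of_nat m ^ j) (charlier m)"
  by (induction j) (simp_all add: number_op_smult number_op_charlier mult.commute)

text \<open>On Charlier polynomials, \<open>D\<close> decides whether an open block is continued,
  the power of \<open>Z\<close> supplies the \<open>j\<close>-th power of the resulting increment of
  the exponent, and \<open>Y\<close> decides whether the block of the new element stays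
  open.\<close>

definition step_op :: "nat \<Rightarrow> rat poly \<Rightarrow> rat poly" where
  "step_op j f = raising ((number_op ^^ j) (shifting f))"

lemma step_op_add: "step_op j (f + g) = step_op j f + step_op j g"
  and step_op_smult: "step_op j (smult c f) = smult c (step_op j f)"
  by (simp_all add: step_op_def raising_add raising_smult shifting_add shifting_smult number_op_funpow_add number_op_funpow_smult)

lemma step_op_0 [simp]: "step_op j 0 = 0"
  using step_op_smult[of j 0 0] by simp

lemma step_op_sum: "step_op j (\<Sum>i\<in>I. f i) = (\<Sum>i\<in>I. step_op j (f i))"
  by (induction I rule: infinite_finite_induct) (simp_all add: step_op_add)

lemma raising_charlier: "raising (charlier m) = charlier (Suc m) + charlier m"
  by simp

lemma step_op_charlier: "step_op j (charlier m) =
    smult (of_nat m ^ j) (charlier (Suc m) + charlier m) +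
    smult (of_nat m * (of_nat m - 1) ^ j) (charlier m + charlier (m - 1))"
proof (cases m)
  case 0
  then show ?thesis
    by (simp add: step_op_def shifting_charlier number_op_funpow_charlier raising_smult del: charlier.simps)
       (simp add: raising_charlier)
next
  case (Suc l)
  have "step_op j (charlier m) = raising (smult (of_nat m ^ j) (charlier m) + smult (of_nat m * of_nat l ^ j) (charlier l))"
    unfolding step_op_def shifting_charlier number_op_funpow_add number_op_funpow_smult number_op_funpow_charlier using Suc by simp
  also have "\<dots> = smult (of_nat m ^ j) (charlier (Suc m) + charlier m) + smult (of_nat m * of_nat l ^ j) (charlier m + charlier l)"
    unfolding raising_add raising_smult raising_charlier using Suc by simp
  finally show ?thesis using Suc by simp
qed

section \<open>Polynomial-valued moments and their recurrence\<close>

definition moment_poly :: "nat \<Rightarrow> nat \<Rightarrow> rat poly" where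
  "moment_poly k n = open_sum n (\<lambda>d m. smult (of_int d ^ k) (charlier m))"

text \<open>\<open>moment_poly k n\<close> is \<open>\<phi>\<^sub>k (n)\<close> of the overview; the
  functional discards all states with an open block.\<close>

lemma bell_functional_moment_poly: "bell_functional (moment_poly k n) = of_int (dim_moment k n)"
proof -
  have "bell_functional (moment_poly k n) = open_sum n (\<lambda>d m. if m = 0 then of_int d ^ k else 0)"
    unfolding moment_poly_def open_sum_def bell_functional_sum bell_functional_smult bell_functional_charlier
    by (intro sum.cong refl) simp
  also have "\<dots> = of_int (dim_moment k n)"
    unfolding dim_moment_open_sum open_sum_def of_int_sum by (intro sum.cong refl) simp
  finally show ?thesis .
qed

lemma moment_poly_0: "moment_poly k 0 = (if k = 0 then 1 else 0)"
  by (cases k) (simp_all add: moment_poly_def open_sum_0)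

lemma smult_sum_right: "smult c (\<Sum>i\<in>I. f i) = (\<Sum>i\<in>I. smult c (f i))"
  by (induction I rule: infinite_finite_induct) (simp_all add: smult_add_right)

text \<open>The binomial theorem splits the \<open>k\<close>-th power of old exponent plus
  increment: powers of the old exponent form lower moments, and \<open>step_op\<close> supplies the
  powers of the increment.\<close>

lemma moment_poly_Suc:
  "moment_poly k (Suc n) = (\<Sum>j\<le>k. smult (of_nat (k choose j)) (step_op j (moment_poly (k - j) n)))"
proof -
  \<comment> \<open>The identity for one state, \<open>d\<close> being its exponent. The two
    binomial sums belong to the increments \<open>m\<close> and \<open>m - 1\<close>.\<close>
  have *: "(\<Sum>j\<le>k. smult (of_nat (k choose j) * d ^ (k - j)) (step_op j (charlier m))) =
      smult ((d + of_nat m) ^ k) (charlier m) + smult ((d + of_nat m) ^ k) (charlier (Suc m)) +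
      of_nat m * (smult ((d + of_nat m - 1) ^ k) (charlier (m - 1)) + smult ((d + of_nat m - 1) ^ k) (charlier m))"
    for d :: rat and m
  proof -
    have "(\<Sum>j\<le>k. smult (of_nat (k choose j) * d ^ (k - j)) (step_op j (charlier m))) =
       smult (\<Sum>j\<le>k. of_nat (k choose j) * of_nat m ^ j * d ^ (k - j)) (charlier (Suc m) + charlier m) +
       smult (of_nat m * (\<Sum>j\<le>k. of_nat (k choose j) * (of_nat m - 1) ^ j * d ^ (k - j))) (charlier m + charlier (m - 1))"
      unfolding step_op_charlier
      by (simp add: smult_add_right sum.distrib smult_sum sum_distrib_left smult_smult mult_ac del: charlier.simps)
    also have "\<dots> = smult ((of_nat m + d) ^ k) (charlier (Suc m) + charlier m) +
       smult (of_nat m * ((of_nat m - 1) + d) ^ k) (charlier m + charlier (m - 1))"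
      by (simp only: binomial_ring)
    also have "\<dots> = smult ((d + of_nat m) ^ k) (charlier m) + smult ((d + of_nat m) ^ k) (charlier (Suc m)) +
      of_nat m * (smult ((d + of_nat m - 1) ^ k) (charlier (m - 1)) + smult ((d + of_nat m - 1) ^ k) (charlier m))"
      by (simp add: of_nat_poly smult_add_right algebra_simps del: charlier.simps)
    finally show ?thesis .
  qed
  have "moment_poly k (Suc n) = open_sum n (\<lambda>d m.
      \<Sum>j\<le>k. smult (of_nat (k choose j) * of_int d ^ (k - j)) (step_op j (charlier m)))"
    unfolding moment_poly_def open_sum_Suc * by simp
  also have "\<dots> = (\<Sum>j\<le>k. open_sum n (\<lambda>d m. smult (of_nat (k choose j) * of_int d ^ (k - j)) (step_op j (charlier m))))"
    unfolding open_sum_def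
    by (rule trans[OF sum.cong[OF refl sum.swap] sum.swap])
  also have "\<dots> = (\<Sum>j\<le>k. smult (of_nat (k choose j)) (step_op j (moment_poly (k - j) n)))"
    unfolding moment_poly_def open_sum_def step_op_sum step_op_smult smult_sum_right smult_smult ..
  finally show ?thesis .
qed

lemma moment_poly_zero: "moment_poly 0 n = \<xi> ^ n"
  by (induction n) (simp_all add: moment_poly_0 moment_poly_Suc step_op_def raising_shifting)

text \<open>The zeroth moment counts set partitions, so the transfer rule itself evaluates the
  functional on powers.\<close>

lemma bell_functional_power: "bell_functional (\<xi> ^ n) = of_nat (bell n)"
  using bell_functional_moment_poly[of 0 n]
  by (simp add: moment_poly_zero dim_moment_def bell_def)

section \<open>Solving the moment recurrence\<close>

text \<open>One signed index suffices: \<open>Y D\<close> is multiplication by \<open>\<xi>\<close>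
  and \<open>D Y\<close> is multiplication by \<open>\<xi> + 1\<close>, so mixed words reduce to
  pure powers.\<close>

definition ladder :: "int \<Rightarrow> rat poly \<Rightarrow> rat poly" where
  "ladder b f = (if b \<ge> 0 then (raising ^^ nat b) f else (shifting ^^ nat (- b)) f)"

lemma raising_ladder:
  "raising (ladder b f) = (if b \<ge> 0 then ladder (b + 1) f
     else \<xi> * ladder (b + 1) f)"
proof (cases "b \<ge> 0")
  case True
  then have "nat (b + 1) = Suc (nat b)" by simp
  then show ?thesis using True by (simp add: ladder_def)
next
  case False
  then have "nat (- b) = Suc (nat (- (b + 1)))" by simp
  then show ?thesis using False by (auto simp: ladder_def raising_shifting)
qed

lemma shifting_mult_\<xi>: "shifting (\<xi> * f) = \<xi> * shifting f + shifting f"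
  by (rule rat_poly_eqI) (simp add: poly_shifting algebra_simps)

lemma raising_mult_\<xi>: "\<xi> * raising f = raising (\<xi> * f) + raising f"
  by (rule rat_poly_eqI) (simp add: poly_raising algebra_simps)

lemma shifting_ladder:
  "shifting (ladder b f) = (if b \<le> 0 then ladder (b - 1) f
     else \<xi> * ladder (b - 1) f + ladder (b - 1) f)"
proof (cases "b \<le> 0")
  case True
  then have "nat (- (b - 1)) = Suc (nat (- b))" by simp
  then show ?thesis using True by (cases "b = 0") (simp_all add: ladder_def)
next
  case False
  then have "nat b = Suc (nat (b - 1))" by simp
  then show ?thesis using False by (simp add: ladder_def shifting_raising raising_shifting)
qed

lemma \<xi>_raising_funpow: "\<xi> * (raising ^^ m) f = (raising ^^ m) (\<xi> * f) + smult (of_nat m) ((raising ^^ m) f)"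
  by (induction m) (simp_all add: raising_mult_\<xi> raising_add raising_smult smult_add_left algebra_simps)

lemma \<xi>_shifting_funpow: "\<xi> * (shifting ^^ m) f = (shifting ^^ m) (\<xi> * f) - smult (of_nat m) ((shifting ^^ m) f)"
proof (induction m)
  case (Suc m)
  have "\<xi> * (shifting ^^ Suc m) f = shifting (\<xi> * (shifting ^^ m) f) - (shifting ^^ Suc m) f"
    by (simp add: shifting_mult_\<xi>)
  then show ?case unfolding Suc
    by (simp add: shifting_diff shifting_smult smult_add_left)
qed simp

text \<open>Moving \<open>\<xi>\<close> inward past one \<open>Y\<close> adds 1 to the correction
  coefficient, past one \<open>D\<close> it subtracts 1.\<close>

lemma \<xi>_ladder: "\<xi> * ladder b f = ladder b (\<xi> * f) + smult (of_int b) (ladder b f)"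
  by (simp add: ladder_def \<xi>_raising_funpow \<xi>_shifting_funpow)

definition ladder_seq :: "int \<Rightarrow> nat \<Rightarrow> nat \<Rightarrow> nat \<Rightarrow> rat poly" where
  "ladder_seq b e i n = smult (of_nat n ^ e) (ladder b (\<xi> ^ (n + i)))"

lemma \<xi>_ladder_seq: "\<xi> * ladder_seq b e i n = ladder_seq b e (Suc i) n + smult (of_int b) (ladder_seq b e i n)"
  using \<xi>_ladder[of b "\<xi> ^ (n + i)"] 
  by (simp add: ladder_seq_def smult_add_right mult.commute)

lemma raising_ladder_seq:
  "raising (ladder_seq b e i n) = (if b \<ge> 0 then ladder_seq (b + 1) e i n else \<xi> * ladder_seq (b + 1) e i n)"
  by (simp add: ladder_seq_def raising_smult raising_ladder)

lemma shifting_ladder_seq: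
  "shifting (ladder_seq b e i n) = (if b \<le> 0 then ladder_seq (b - 1) e i n else \<xi> * ladder_seq (b - 1) e i n + ladder_seq (b - 1) e i n)"
  by (simp add: ladder_seq_def shifting_smult shifting_ladder smult_add_right)

section \<open>Spans of basis sequences and their weight bounds\<close>

inductive_set seq_span :: "(nat \<Rightarrow> rat poly) set \<Rightarrow> (nat \<Rightarrow> rat poly) set" for G where
  seq_span_0: "(\<lambda>n. 0) \<in> seq_span G"
| seq_span_step: "g \<in> G \<Longrightarrow> f \<in> seq_span G \<Longrightarrow> (\<lambda>n. smult c (g n) + f n) \<in> seq_span G"

lemma seq_span_base: "g \<in> G \<Longrightarrow> g \<in> seq_span G"
  using seq_span_step[of g G "\<lambda>n. 0" 1] seq_span_0 by simp

lemma seq_span_add: "f \<in> seq_span G \<Longrightarrow> g \<in> seq_span G \<Longrightarrow> (\<lambda>n. f n + g n) \<in> seq_span G"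
  by (induction rule: seq_span.induct) (simp_all add: add.assoc seq_span_step)

lemma seq_span_smult: "f \<in> seq_span G \<Longrightarrow> (\<lambda>n. smult c (f n)) \<in> seq_span G"
  by (induction rule: seq_span.induct) (simp_all add: smult_add_right seq_span_step seq_span_0)

lemma seq_span_diff: "f \<in> seq_span G \<Longrightarrow> g \<in> seq_span G \<Longrightarrow> (\<lambda>n. f n - g n) \<in> seq_span G"
  using seq_span_add[of f G "\<lambda>n. smult (-1) (g n)"] seq_span_smult[of g G "-1"] by simp

lemma seq_span_sum: "(\<And>i. i \<in> I \<Longrightarrow> f i \<in> seq_span G) \<Longrightarrow> (\<lambda>n. \<Sum>i\<in>I. f i n) \<in> seq_span G"
  by (induction I rule: infinite_finite_induct) (simp_all add: seq_span_0 seq_span_add)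

text \<open>\<open>\<Phi>\<close> acts on whole sequences rather than termwise, because solving a
  recurrence at \<open>n\<close> uses all earlier source terms.\<close>

lemma seq_span_map:
  fixes \<Phi> :: "(nat \<Rightarrow> rat poly) \<Rightarrow> nat \<Rightarrow> rat poly"
  assumes "\<And>c f g n. \<Phi> (\<lambda>n. smult c (f n) + g n) n = smult c (\<Phi> f n) + \<Phi> g n"
    and "\<And>g. g \<in> G \<Longrightarrow> \<Phi> g \<in> seq_span H" and "f \<in> seq_span G"
  shows "\<Phi> f \<in> seq_span H"
  using assms(3)
proof (induction rule: seq_span.induct)
  case seq_span_0
  have "\<Phi> (\<lambda>n. 0) n = 0" for n using assms(1)[of 1 "\<lambda>n. 0" "\<lambda>n. 0" n] by simp
  then have "\<Phi> (\<lambda>n. 0) = (\<lambda>n. 0)" by auto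
  then show ?case by (simp add: seq_span.seq_span_0)
next
  case (seq_span_step g f c)
  have "\<Phi> (\<lambda>n. smult c (g n) + f n) = (\<lambda>n. smult c (\<Phi> g n) + \<Phi> f n)"
    using assms(1) by auto
  then show ?case using assms(2) seq_span_step by (simp add: seq_span_add seq_span_smult)
qed

text \<open>The index \<open>b = 0\<close> is the resonant one: there the solution of the recurrence gains a power of \<open>n\<close> and
  loses a power of \<open>\<xi>\<close>, which needs \<open>i \<ge> 1\<close> and costs \<open>3\<close> in \<open>2e - i\<close>. Hence the separate bounds \<open>w0\<close>
  and \<open>m\<close>.\<close>

definition moment_class :: "int \<Rightarrow> int \<Rightarrow> int \<Rightarrow> nat \<Rightarrow> (nat \<Rightarrow> rat poly) set" where
  "moment_class A w w0 m = seq_span {ladder_seq b e i | b e i. \<bar>b\<bar> + int e + int i \<le> A \<and>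
     (if b = 0 then 2 * int e - int i \<le> w0 \<and> m \<le> i else 2 * int e - int i \<le> w)}"

lemma ladder_seq_moment_class: "\<bar>b\<bar> + int e + int i \<le> A \<Longrightarrow> (b = 0 \<Longrightarrow> 2 * int e - int i \<le> w0 \<and> m \<le> i) \<Longrightarrow>
   (b \<noteq> 0 \<Longrightarrow> 2 * int e - int i \<le> w) \<Longrightarrow> ladder_seq b e i \<in> moment_class A w w0 m"
  unfolding moment_class_def by (intro seq_span_base CollectI exI[of _ b] exI[of _ e] exI[of _ i]) auto

lemma moment_class_map:
  assumes "\<And>c f g n. \<Phi> (\<lambda>n. smult c (f n) + g n) n = smult c (\<Phi> f n) + \<Phi> g n"
    and "\<And>b e i. \<bar>b\<bar> + int e + int i \<le> A \<Longrightarrow> (b = 0 \<Longrightarrow> 2 * int e - int i \<le> w0 \<and> m \<le> i) \<Longrightarrow>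
       (b \<noteq> 0 \<Longrightarrow> 2 * int e - int i \<le> w) \<Longrightarrow> \<Phi> (ladder_seq b e i) \<in> moment_class A' w' w0' m'"
    and "f \<in> moment_class A w w0 m"
  shows "\<Phi> f \<in> moment_class A' w' w0' m'"
proof -
  have "\<Phi> g \<in> moment_class A' w' w0' m'"
    if "g \<in> {ladder_seq b e i | b e i. \<bar>b\<bar> + int e + int i \<le> A \<and>
      (if b = 0 then 2 * int e - int i \<le> w0 \<and> m \<le> i else 2 * int e - int i \<le> w)}" for g
    using that assms(2) by (elim CollectE exE conjE) (simp split: if_splits)
  then show ?thesis
    using assms(3) unfolding moment_class_def by (rule seq_span_map[of \<Phi>, OF assms(1)])
qed

lemma moment_class_mono:
  assumes "f \<in> moment_class A w w0 m" "A \<le> A'" "w \<le> w'" "w0 \<le> w0'" "m' \<le> m"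
  shows "f \<in> moment_class A' w' w0' m'"
proof (rule moment_class_map[where \<Phi> = "\<lambda>f. f", OF _ _ assms(1)])
  fix b e i assume "\<bar>b\<bar> + int e + int i \<le> A" "b = 0 \<Longrightarrow> 2 * int e - int i \<le> w0 \<and> m \<le> i"
    "b \<noteq> 0 \<Longrightarrow> 2 * int e - int i \<le> w"
  then show "ladder_seq b e i \<in> moment_class A' w' w0' m'"
    by (intro ladder_seq_moment_class) (use assms in auto)
qed simp

lemma moment_class_add: "f \<in> moment_class A w w0 m \<Longrightarrow> g \<in> moment_class A w w0 m \<Longrightarrow> (\<lambda>n. f n + g n) \<in> moment_class A w w0 m"
  and moment_class_diff: "f \<in> moment_class A w w0 m \<Longrightarrow> g \<in> moment_class A w w0 m \<Longrightarrow> (\<lambda>n. f n - g n) \<in> moment_class A w w0 m"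
  and moment_class_smult: "f \<in> moment_class A w w0 m \<Longrightarrow> (\<lambda>n. smult c (f n)) \<in> moment_class A w w0 m"
  unfolding moment_class_def by (simp_all add: seq_span_add seq_span_diff seq_span_smult)

lemma moment_class_sum: "(\<And>i. i \<in> I \<Longrightarrow> f i \<in> moment_class A w w0 m) \<Longrightarrow> (\<lambda>n. \<Sum>i\<in>I. f i n) \<in> moment_class A w w0 m"
  unfolding moment_class_def by (rule seq_span_sum)

lemmas moment_class_intros = moment_class_add moment_class_diff moment_class_smult moment_class_sum ladder_seq_moment_class

lemma shifting_moment_class:
  assumes "f \<in> moment_class A w w 0" shows "(\<lambda>n. shifting (f n)) \<in> moment_class (A + 1) w w 0"
  using _ _ assms
proof (rule moment_class_map[where \<Phi> = "\<lambda>f n. shifting (f n)"])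
  fix b e i assume *: "\<bar>b\<bar> + int e + int i \<le> A" "b = 0 \<Longrightarrow> 2 * int e - int i \<le> w \<and> 0 \<le> i"
    "b \<noteq> 0 \<Longrightarrow> 2 * int e - int i \<le> w"
  show "(\<lambda>n. shifting (ladder_seq b e i n)) \<in> moment_class (A + 1) w w 0"
  proof (cases "b \<le> 0")
    case True
    then show ?thesis using * by (simp add: shifting_ladder_seq) (rule ladder_seq_moment_class; linarith)
  next
    case False
    then show ?thesis using * 
      by (simp add: shifting_ladder_seq \<xi>_ladder_seq) (intro moment_class_intros; linarith)
  qed
qed (simp add: shifting_add shifting_smult)

text \<open>Only \<open>b = -1\<close> leads to the resonant index, and there \<open>Y D\<close>
  yields one more power of \<open>\<xi>\<close>: hence \<open>i \<ge> 1\<close> and the drop of the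
  weight to \<open>w - 1\<close>.\<close>

lemma raising_moment_class:
  assumes "f \<in> moment_class A w w 0" shows "(\<lambda>n. raising (f n)) \<in> moment_class (A + 1) w (w - 1) 1"
  using _ _ assms
proof (rule moment_class_map[where \<Phi> = "\<lambda>f n. raising (f n)"])
  fix b e i assume *: "\<bar>b\<bar> + int e + int i \<le> A" "b = 0 \<Longrightarrow> 2 * int e - int i \<le> w \<and> 0 \<le> i"
    "b \<noteq> 0 \<Longrightarrow> 2 * int e - int i \<le> w"
  consider "b \<ge> 0" | "b = -1" | "b < -1" by linarith
  then show "(\<lambda>n. raising (ladder_seq b e i n)) \<in> moment_class (A + 1) w (w - 1) 1"
  proof cases
    case 1
    then show ?thesis using * by (simp add: raising_ladder_seq) (rule ladder_seq_moment_class; linarith)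
  next
    case 2
    then show ?thesis using *
      by (simp add: raising_ladder_seq \<xi>_ladder_seq) (rule ladder_seq_moment_class; simp)
  next
    case 3
    then show ?thesis using *
      by (simp add: raising_ladder_seq \<xi>_ladder_seq) (intro moment_class_intros; linarith)
  qed
qed (simp add: raising_add raising_smult)

lemma \<xi>_moment_class:
  assumes "f \<in> moment_class A w w 0" shows "(\<lambda>n. \<xi> * f n) \<in> moment_class (A + 1) w w 0"
  using _ _ assms
proof (rule moment_class_map[where \<Phi> = "\<lambda>f n. \<xi> * f n"])
  fix b e i assume *: "\<bar>b\<bar> + int e + int i \<le> A" "b = 0 \<Longrightarrow> 2 * int e - int i \<le> w \<and> 0 \<le> i"
    "b \<noteq> 0 \<Longrightarrow> 2 * int e - int i \<le> w"
  show "(\<lambda>n. \<xi> * ladder_seq b e i n) \<in> moment_class (A + 1) w w 0"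
    unfolding \<xi>_ladder_seq by (intro moment_class_intros; use * in linarith)
qed (simp add: algebra_simps smult_add_right)

lemma number_op_moment_class:
  assumes "f \<in> moment_class A w w 0" shows "(\<lambda>n. number_op (f n)) \<in> moment_class (A + 1) w w 0"
  unfolding number_op_def
  by (intro moment_class_add moment_class_diff \<xi>_moment_class shifting_moment_class assms moment_class_mono[OF raising_moment_class[OF assms]] moment_class_mono[OF assms]) auto

lemma number_op_funpow_moment_class:
  "f \<in> moment_class A w w 0 \<Longrightarrow> (\<lambda>n. (number_op ^^ j) (f n)) \<in> moment_class (A + int j) w w 0"
proof (induction j)
  case (Suc j)
  then show ?case using number_op_moment_class[of "\<lambda>n. (number_op ^^ j) (f n)" "A + int j" w] by (simp add: add_ac)
qed simp

lemma step_op_moment_class: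
  assumes "f \<in> moment_class A w w 0" shows "(\<lambda>n. step_op j (f n)) \<in> moment_class (A + int j + 2) w (w - 1) 1"
  unfolding step_op_def
  using raising_moment_class[OF number_op_funpow_moment_class[OF shifting_moment_class[OF assms], of j]] by (simp add: add_ac)

lemma step_op_1: "step_op 1 f = \<xi> * (\<xi> * f) - raising (\<xi> * f) - \<xi> * shifting f"
  by (rule rat_poly_eqI) (simp add: step_op_def number_op_def poly_raising poly_shifting algebra_simps)

text \<open>For \<open>j = 1\<close> the bound of \<open>step_op_moment_class\<close> is too weak:
  solving the recurrence would end at weight \<open>k + 1\<close>. Here contributions to index 0
  gain two powers of \<open>\<xi>\<close> if they come from \<open>b = 0\<close>, and at least one
  if they come from \<open>b = 1\<close> or \<open>b = -1\<close>, where the input weight is already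
  smaller by one.\<close>

lemma step_op_1_moment_class:
  assumes "f \<in> moment_class A (k - 2) (k - 1) 0" shows "(\<lambda>n. step_op 1 (f n)) \<in> moment_class (A + 2) (k - 1) (k - 3) 1"
  using _ _ assms
proof (rule moment_class_map[where \<Phi> = "\<lambda>f n. step_op 1 (f n)"])
  fix b e i assume *: "\<bar>b\<bar> + int e + int i \<le> A" "b = 0 \<Longrightarrow> 2 * int e - int i \<le> k - 1 \<and> 0 \<le> i"
    "b \<noteq> 0 \<Longrightarrow> 2 * int e - int i \<le> k - 2"
  have X: "(\<lambda>n. \<xi> * (\<xi> * ladder_seq b e i n)) \<in> moment_class (A + 2) (k - 1) (k - 3) 1"
  proof (cases "b = 0")
    case True
    then show ?thesis unfolding \<xi>_ladder_seq distrib_left mult_smult_right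
      using * by simp (rule ladder_seq_moment_class; simp)
  next
    case False
    then show ?thesis unfolding \<xi>_ladder_seq distrib_left mult_smult_right
      by (intro moment_class_intros; use * in linarith)
  qed
  have R: "(\<lambda>n. raising (\<xi> * ladder_seq b e i n)) \<in> moment_class (A + 2) (k - 1) (k - 3) 1"
  proof -
    consider "b \<ge> 0" | "b = -1" | "b < -1" by linarith
    then show ?thesis
    proof cases
      case 1
      then show ?thesis unfolding \<xi>_ladder_seq raising_add raising_smult raising_ladder_seq 
        using * by (cases "b = 0"; simp) (intro moment_class_intros; linarith)+
    next
      case 2
      then show ?thesis unfolding \<xi>_ladder_seq raising_add raising_smult raising_ladder_seq 
        using * by (simp add: \<xi>_ladder_seq) (intro moment_class_intros; simp)
    next
      case 3
      then show ?thesis unfolding \<xi>_ladder_seq raising_add raising_smult raising_ladder_seq 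
        using * by (simp add: \<xi>_ladder_seq) (intro moment_class_intros; linarith)
    qed
  qed
  have S: "(\<lambda>n. \<xi> * shifting (ladder_seq b e i n)) \<in> moment_class (A + 2) (k - 1) (k - 3) 1"
  proof -
    consider "b = 0" | "b < 0" | "b = 1" | "b > 1" by linarith
    then show ?thesis
    proof cases
      case 1
      then show ?thesis unfolding shifting_ladder_seq
        using * by (simp add: \<xi>_ladder_seq) (intro moment_class_intros; simp)
    next
      case 2
      then show ?thesis unfolding shifting_ladder_seq
        using * by (simp add: \<xi>_ladder_seq) (intro moment_class_intros; linarith)
    next
      case 3
      then show ?thesis unfolding shifting_ladder_seq
        using * by (simp add: \<xi>_ladder_seq distrib_left) (intro moment_class_intros; simp)
    next
      case 4
      then show ?thesis unfolding shifting_ladder_seq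
        using * by (simp add: \<xi>_ladder_seq distrib_left) (intro moment_class_intros; linarith)
    qed
  qed
  show "(\<lambda>n. step_op 1 (ladder_seq b e i n)) \<in> moment_class (A + 2) (k - 1) (k - 3) 1"
    unfolding step_op_1 by (intro moment_class_diff X R S)
qed (simp add: step_op_add step_op_smult)

section \<open>The first-order recurrence with a source term\<close>

fun solve_rec :: "(nat \<Rightarrow> rat poly) \<Rightarrow> nat \<Rightarrow> rat poly" where
  "solve_rec s 0 = 0"
| "solve_rec s (Suc n) = \<xi> * solve_rec s n + s n"

lemma solve_rec_add: "solve_rec (\<lambda>n. f n + g n) n = solve_rec f n + solve_rec g n"
  by (induction n) (simp_all add: algebra_simps)

lemma solve_rec_smult: "solve_rec (\<lambda>n. smult c (f n)) n = smult c (solve_rec f n)"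
  by (induction n) (simp_all add: smult_add_right)

lemma solve_rec_sum: "solve_rec (\<lambda>n. \<Sum>i\<in>I. f i n) n = (\<Sum>i\<in>I. solve_rec (f i) n)"
  by (induction n) (simp_all add: sum.distrib sum_distrib_left)

lemma solve_rec_unique:
  "(\<And>n. g (Suc n) = \<xi> * g n + s n) \<Longrightarrow> g n = solve_rec s n + \<xi> ^ n * g 0"
  by (induction n) (simp_all add: algebra_simps)

lemma power_Suc_diff: "(of_nat (Suc n) :: rat) ^ e = of_nat n ^ e + (\<Sum>l<e. of_nat (e choose l) * of_nat n ^ l)"
proof -
  have "(of_nat (Suc n) :: rat) ^ e = (of_nat n + 1) ^ e" by (simp add: add.commute)
  also have "\<dots> = (\<Sum>l\<le>e. of_nat (e choose l) * of_nat n ^ l)"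
    by (subst binomial_ring) simp
  also have "{..e} = insert e {..<e}" by auto
  finally show ?thesis by simp
qed

text \<open>This exhibits the source that each basis sequence solves: \<open>- b\<close> times
  itself plus terms with lower powers of \<open>n\<close>. For \<open>b \<noteq> 0\<close> one can
  divide by \<open>b\<close>; for \<open>b = 0\<close> the leading source has
  \<open>l = e - 1\<close>.\<close>

lemma ladder_seq_Suc: "ladder_seq b e i (Suc n) = \<xi> * ladder_seq b e i n + (smult (- of_int b) (ladder_seq b e i n) +
   (\<Sum>l<e. smult (of_nat (e choose l)) (ladder_seq b l (Suc i) n)))"
proof -
  have "ladder_seq b e i (Suc n) = smult (of_nat (Suc n) ^ e) (ladder b (\<xi> ^ (n + Suc i)))"
    by (simp add: ladder_seq_def)
  also have "\<dots> = ladder_seq b e (Suc i) n + (\<Sum>l<e. smult (of_nat (e choose l)) (ladder_seq b l (Suc i) n))"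
    unfolding power_Suc_diff smult_add_left smult_sum by (simp add: ladder_seq_def)
  also have "ladder_seq b e (Suc i) n = \<xi> * ladder_seq b e i n + smult (- of_int b) (ladder_seq b e i n)"
    unfolding \<xi>_ladder_seq by simp
  finally show ?thesis by (simp add: add.assoc)
qed

lemma degree_ladder: "degree (ladder b f) \<le> nat \<bar>b\<bar> + degree f"
proof -
  have "degree ((raising ^^ m) f) \<le> m + degree f" for m
  proof (induction m)
    case (Suc m)
    then show ?case using degree_raising[of "(raising ^^ m) f"] by simp
  qed simp
  moreover have "degree ((shifting ^^ m) f) = degree f" for m
    by (induction m) (simp_all add: shifting_def degree_pcompose)
  ultimately show ?thesis by (simp add: ladder_def)
qed

text \<open>Homogeneous solutions are combinations of terms with \<open>b = 0\<close> and
  \<open>e = 0\<close>, whose weight \<open>- i\<close> is at most 0.\<close>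

lemma \<xi>_power_times_moment_class:
  assumes "int (degree r) \<le> A" "w0 \<ge> 0"
  shows "(\<lambda>n. \<xi> ^ n * r) \<in> moment_class A w w0 0"
proof -
  have "\<xi> ^ n * r = (\<Sum>i\<le>degree r. smult (coeff r i) (ladder_seq 0 0 i n))" for n
  proof -
    have "\<xi> ^ n * r = \<xi> ^ n * (\<Sum>i\<le>degree r. monom (coeff r i) i)"
      by (simp add: poly_as_sum_of_monoms)
    also have "\<dots> = (\<Sum>i\<le>degree r. smult (coeff r i) (\<xi> ^ (n + i)))"
      by (simp add: sum_distrib_left monom_altdef power_add flip: \<xi>_def)
    finally show ?thesis by (simp add: ladder_seq_def ladder_def)
  qed
  then show ?thesis using assms by (simp only:) (intro moment_class_sum moment_class_smult ladder_seq_moment_class; simp)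
qed

text \<open>By \<open>ladder_seq_Suc\<close> the solution is the source itself divided by
  \<open>- b\<close>, up to solutions for smaller \<open>e\<close> and a homogeneous term from the
  initial value.\<close>

lemma solve_rec_ladder_seq_nonzero:
  assumes "b \<noteq> 0" "w0 \<ge> 0"
  shows "\<bar>b\<bar> + int e + int i \<le> A \<Longrightarrow> 2 * int e - int i \<le> w \<Longrightarrow> solve_rec (ladder_seq b e i) \<in> moment_class A w w0 0"
proof (induction e arbitrary: i rule: less_induct)
  case (less e)
  let ?S = "\<lambda>n. \<Sum>l<e. smult (of_nat (e choose l)) (solve_rec (ladder_seq b l (Suc i)) n)"
  have eq: "ladder_seq b e i n = smult (- of_int b) (solve_rec (ladder_seq b e i) n) + ?S n + \<xi> ^ n * ladder_seq b e i 0" for n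
    using solve_rec_unique[of "ladder_seq b e i", OF ladder_seq_Suc, of n] by (simp only: solve_rec_add solve_rec_smult solve_rec_sum)
  have "solve_rec (ladder_seq b e i) n = smult (- 1 / of_int b) (ladder_seq b e i n - ?S n - \<xi> ^ n * ladder_seq b e i 0)" for n
    using assms(1) by (subst eq) simp
  moreover have "(\<lambda>n. \<xi> ^ n * ladder_seq b e i 0) \<in> moment_class A w w0 0"
  proof (rule \<xi>_power_times_moment_class)
    have "degree (ladder_seq b e i 0) \<le> nat \<bar>b\<bar> + degree (\<xi> ^ i)"
      using degree_ladder[of b "\<xi> ^ i"] by (auto simp: ladder_seq_def)
    then have "degree (ladder_seq b e i 0) \<le> nat \<bar>b\<bar> + i" using degree_power_le[of \<xi> i] by simp
    then show "int (degree (ladder_seq b e i 0)) \<le> A" using less.prems by linarith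
  qed fact
  moreover have "?S \<in> moment_class A w w0 0"
    by (intro moment_class_sum moment_class_smult less.IH) (use less.prems in auto)
  moreover have "ladder_seq b e i \<in> moment_class A w w0 0"
    by (rule ladder_seq_moment_class) (use less.prems assms in auto)
  ultimately show ?case by (simp only: moment_class_diff moment_class_smult)
qed

text \<open>The leading source of \<open>ladder_seq 0 (Suc e) i\<close> is \<open>Suc e\<close>
  times the given one. As \<open>n ^ Suc e\<close> vanishes at 0, no homogeneous term
  arises.\<close>

lemma solve_rec_ladder_seq_zero:
  "int e + int i < A \<Longrightarrow> 2 * int e - int i \<le> w0 \<Longrightarrow> solve_rec (ladder_seq 0 e (Suc i)) \<in> moment_class A w (w0 + 2) 0"
proof (induction e rule: less_induct)
  case (less e)
  let ?S = "\<lambda>n. \<Sum>l<e. smult (of_nat (Suc e choose l)) (solve_rec (ladder_seq 0 l (Suc i)) n)"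
  have "ladder_seq 0 (Suc e) i n = smult (of_nat (Suc e)) (solve_rec (ladder_seq 0 e (Suc i)) n) + ?S n" for n
    using solve_rec_unique[of "ladder_seq 0 (Suc e) i", OF ladder_seq_Suc, of n]
    by (simp add: solve_rec_add solve_rec_smult solve_rec_sum ladder_seq_def[of _ _ _ 0])
  then have "solve_rec (ladder_seq 0 e (Suc i)) n = smult (1 / of_nat (Suc e)) (ladder_seq 0 (Suc e) i n - ?S n)" for n
    by (simp del: of_nat_Suc)
  moreover have "?S \<in> moment_class A w (w0 + 2) 0"
    by (intro moment_class_sum moment_class_smult less.IH) (use less.prems in auto)
  moreover have "ladder_seq 0 (Suc e) i \<in> moment_class A w (w0 + 2) 0"
    by (rule ladder_seq_moment_class) (use less.prems in auto)
  ultimately show ?case by (simp only: moment_class_diff moment_class_smult)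
qed

lemma solve_rec_moment_class:
  assumes "f \<in> moment_class A w w0 1" "w0 + 3 \<ge> 0"
  shows "solve_rec f \<in> moment_class A w (w0 + 3) 0"
  using _ _ assms(1)
proof (rule moment_class_map[where \<Phi> = solve_rec])
  fix b e i assume *: "\<bar>b\<bar> + int e + int i \<le> A" "b = 0 \<Longrightarrow> 2 * int e - int i \<le> w0 \<and> 1 \<le> i"
    "b \<noteq> 0 \<Longrightarrow> 2 * int e - int i \<le> w"
  show "solve_rec (ladder_seq b e i) \<in> moment_class A w (w0 + 3) 0"
  proof (cases "b = 0")
    case True
    then obtain i' where "i = Suc i'" using * by (cases i) auto
    \<comment> \<open>Replacing \<open>i\<close> by its predecessor raises the weight bound to
      \<open>w0 + 1\<close>, and the extra power of \<open>n\<close> adds 2: together the cost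
      3.\<close>
    then show ?thesis using True * solve_rec_ladder_seq_zero[of e i' A "w0 + 1" w] by (simp add: add.commute)
  qed (use * assms solve_rec_ladder_seq_nonzero in auto)
qed (simp add: solve_rec_add solve_rec_smult)

text \<open>The term \<open>j = 0\<close> is multiplication by \<open>\<xi>\<close>; all others form
  the source. The initial value is 0 since \<open>k > 0\<close>.\<close>

lemma moment_poly_solve_rec:
  assumes "k > 0"
  shows "moment_poly k = solve_rec (\<lambda>n. \<Sum>j\<in>{1..k}. smult (of_nat (k choose j)) (step_op j (moment_poly (k - j) n)))"
    (is "_ = solve_rec ?s")
proof
  fix n
  have "moment_poly k (Suc n) = \<xi> * moment_poly k n + ?s n" for n
  proof -
    have "{..k} = insert 0 {1..k}" by auto
    then show ?thesis unfolding moment_poly_Suc by (simp add: step_op_def[of 0] raising_shifting)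
  qed
  from solve_rec_unique[of "moment_poly k", OF this, of n] assms
  show "moment_poly k n = solve_rec ?s n" by (simp add: moment_poly_0)
qed

text \<open>All source terms have resonant weight at most \<open>k - 3\<close>, so the cost 3 of
  solving leads back to \<open>k\<close>.\<close>

lemma moment_poly_moment_class: "moment_poly k \<in> moment_class (2 * int k) (int k - 1) (int k) 0"
proof (induction k rule: less_induct)
  case (less k)
  show ?case
  proof (cases "k = 0")
    case True
    have "moment_poly 0 = ladder_seq 0 0 0" by (simp add: fun_eq_iff ladder_seq_def ladder_def moment_poly_zero)
    then show ?thesis using True by (simp add: ladder_seq_moment_class)
  next
    case False
    have "(\<lambda>n. step_op j (moment_poly (k - j) n)) \<in> moment_class (2 * int k) (int k - 1) (int k - 3) 1"
      if j: "j \<in> {1..k}" for j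
    proof (cases "j = 1")
      case True
      then have "moment_poly (k - j) \<in> moment_class (2 * int k - 2) (int k - 2) (int k - 1) 0"
        using less[of "k - j"] j by (auto simp: of_nat_diff algebra_simps)
      from step_op_1_moment_class[OF this] show ?thesis using True by simp
    next
      case False
      \<comment> \<open>The bound for \<open>b \<noteq> 0\<close> is relaxed to \<open>k - j\<close>
        to fit \<open>step_op_moment_class\<close>; as \<open>j \<ge> 2\<close>, the resulting
        \<open>k - j - 1\<close> is at most \<open>k - 3\<close>.\<close>
      have "moment_poly (k - j) \<in> moment_class (2 * int (k - j)) (int (k - j)) (int (k - j)) 0"
        by (rule moment_class_mono[OF less[of "k - j"]]) (use j in auto)
      from step_op_moment_class[OF this] show ?thesis
        by (rule moment_class_mono) (use j False in \<open>auto simp: of_nat_diff\<close>)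
    qed
    then have "solve_rec (\<lambda>n. \<Sum>j\<in>{1..k}. smult (of_nat (k choose j)) (step_op j (moment_poly (k - j) n)))
       \<in> moment_class (2 * int k) (int k - 1) (int k - 3 + 3) 0"
      by (intro solve_rec_moment_class moment_class_sum moment_class_smult) auto
    then show ?thesis using False moment_poly_solve_rec[of k] by simp
  qed
qed

section \<open>Passage to Bell numbers with polynomial coefficients\<close>

text \<open>With \<open>i = 2 * k - j\<close> the two inequalities encode the degree bounds for
  \<open>j \<le> k\<close> and for \<open>j > k\<close> without a ceiling.\<close>

definition bell_comb :: "nat \<Rightarrow> (nat \<Rightarrow> rat) \<Rightarrow> bool" where
  "bell_comb k h \<longleftrightarrow> (\<exists>P :: nat \<Rightarrow> rat poly.
     (\<forall>n. h n = (\<Sum>i = 0..2 * k. poly (P i) (of_nat n) * of_nat (bell (n + i)))) \<and>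
     (\<forall>i \<le> 2 * k. degree (P i) + i \<le> 2 * k \<and> 2 * degree (P i) \<le> k + i))"

lemma bell_comb_0: "bell_comb k (\<lambda>n. 0)"
  unfolding bell_comb_def by (intro exI[of _ "\<lambda>i. 0"]) auto

lemma bell_comb_lin:
  assumes "bell_comb k f" "bell_comb k g"
  shows "bell_comb k (\<lambda>n. c * f n + g n)"
proof -
  obtain P where P: "\<And>n. f n = (\<Sum>i = 0..2 * k. poly (P i) (of_nat n) * of_nat (bell (n + i)))"
    "\<And>i. i \<le> 2 * k \<Longrightarrow> degree (P i) + i \<le> 2 * k \<and> 2 * degree (P i) \<le> k + i"
    using assms(1) unfolding bell_comb_def by blast
  obtain Q where Q: "\<And>n. g n = (\<Sum>i = 0..2 * k. poly (Q i) (of_nat n) * of_nat (bell (n + i)))"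
    "\<And>i. i \<le> 2 * k \<Longrightarrow> degree (Q i) + i \<le> 2 * k \<and> 2 * degree (Q i) \<le> k + i"
    using assms(2) unfolding bell_comb_def by blast
  have d: "degree (smult c (P i) + Q i) \<le> max (degree (P i)) (degree (Q i))" for i
    by (intro degree_add_le) (auto simp: le_max_iff_disj)
  show ?thesis unfolding bell_comb_def
  proof (intro exI[of _ "\<lambda>i. smult c (P i) + Q i"] conjI allI impI)
    fix i assume "i \<le> 2 * k"
    then show "degree (smult c (P i) + Q i) + i \<le> 2 * k" "2 * degree (smult c (P i) + Q i) \<le> k + i"
      using d[of i] P(2)[of i] Q(2)[of i] by (auto simp: max_def split: if_splits)
  qed (simp add: P(1) Q(1) sum.distrib sum_distrib_left algebra_simps)
qed

text \<open>The functional ignores \<open>Y\<close> and turns an outer \<open>D\<close> into a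
  factor \<open>\<xi>\<close>. Moving it inward trades one unit of \<open>\<bar>b\<bar>\<close> for
  one of \<open>i\<close>, plus a term of smaller total, so both inequalities survive.\<close>

lemma bell_comb_ladder_seq:
  assumes "\<bar>b\<bar> + int e + int i \<le> 2 * int k" "2 * int e - int i \<le> int k"
  shows "bell_comb k (\<lambda>n. bell_functional (ladder_seq b e i n))"
proof -
  have mon: "bell_comb k (\<lambda>n. of_nat n ^ e * of_nat (bell (n + i)))" if "e + i \<le> 2 * k" "2 * e \<le> k + i" for i
  proof -
    have "of_nat n ^ e * of_nat (bell (n + i)) = (\<Sum>l = 0..2 * k. poly (if l = i then monom 1 e else 0) (of_nat n) * (of_nat (bell (n + l)) :: rat))" for n
    proof -
      have "(\<Sum>l = 0..2 * k. poly (if l = i then monom 1 e else 0) (of_nat n) * (of_nat (bell (n + l)) :: rat))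
        = (\<Sum>l = 0..2 * k. if l = i then of_nat n ^ e * of_nat (bell (n + i)) else 0)"
        by (intro sum.cong) (auto simp: poly_monom)
      then show ?thesis using that by simp
    qed
    moreover have "degree (if l = i then monom (1::rat) e else 0) + l \<le> 2 * k \<and>
        2 * degree (if l = i then monom (1::rat) e else 0) \<le> k + l" if "l \<le> 2 * k" for l
      using \<open>e + i \<le> 2 * k\<close> \<open>2 * e \<le> k + i\<close> that by (auto simp: degree_monom_eq)
    ultimately show ?thesis
      unfolding bell_comb_def by (intro exI[of _ "\<lambda>l. if l = i then monom 1 e else 0"] conjI allI impI) simp_all
  qed
  have pos: "bell_functional (ladder (int m) f) = bell_functional f" for m f
    by (induction m) (simp_all add: ladder_def bell_functional_raising nat_add_distrib)
  have neg: "bell_comb k (\<lambda>n. bell_functional (ladder_seq (- int c) e i n))" if "c + e + i \<le> 2 * k" "2 * e \<le> k + i" for c i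
    using that
  proof (induction c arbitrary: i)
    case 0
    then show ?case using mon[of i] by (simp add: ladder_seq_def ladder_def bell_functional_smult bell_functional_power)
  next
    case (Suc c)
    have "ladder_seq (- int (Suc c)) e i n = shifting (ladder_seq (- int c) e i n)" for n
      by (simp add: shifting_ladder_seq minus_diff_commute)
    then have "bell_functional (ladder_seq (- int (Suc c)) e i n) =
      (- of_nat c) * bell_functional (ladder_seq (- int c) e i n) + bell_functional (ladder_seq (- int c) e (Suc i) n)" for n
      by (simp add: bell_functional_shifting \<xi>_ladder_seq bell_functional_add bell_functional_diff bell_functional_smult)
    then show ?case using Suc.prems
      by (simp only:) (intro bell_comb_lin Suc.IH; simp)
  qed
  show ?thesis
  proof (cases "b \<ge> 0")
    case True
    then have "bell_functional (ladder_seq b e i n) = of_nat n ^ e * of_nat (bell (n + i))" for n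
      using pos[of "nat b" "\<xi> ^ (n + i)"] by (simp add: ladder_seq_def bell_functional_smult bell_functional_power)
    then show ?thesis using mon[of i] True assms by simp
  next
    case False
    then show ?thesis using neg[of "nat (- b)" i] assms by simp
  qed
qed

lemma bell_comb_moment_class:
  assumes "f \<in> moment_class (2 * int k) (int k - 1) (int k) 0"
  shows "bell_comb k (\<lambda>n. bell_functional (f n))"
  using assms unfolding moment_class_def
proof (induction rule: seq_span.induct)
  case seq_span_0
  then show ?case by (simp add: bell_comb_0)
next
  case (seq_span_step g f c)
  then obtain b e i where g: "g = ladder_seq b e i" "\<bar>b\<bar> + int e + int i \<le> 2 * int k" "2 * int e - int i \<le> int k"
    by (auto split: if_splits)
  show ?case unfolding bell_functional_add bell_functional_smult
    by (rule bell_comb_lin) (use g seq_span_step bell_comb_ladder_seq in auto)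
qed

lemma dim_moment_bell_comb: "bell_comb k (\<lambda>n. of_int (dim_moment k n))"
  using bell_comb_moment_class[OF moment_poly_moment_class[of k]] by (simp add: bell_functional_moment_poly)

section \<open>The first two moments\<close>

text \<open>Uniqueness of the solution reduces a proposed closed form to its initial value and the
  recurrence.\<close>

lemma moment_poly_eqI:
  assumes "k > 0" "g 0 = 0"
    and "\<And>n. g (Suc n) = \<xi> * g n + (\<Sum>j\<in>{1..k}. smult (of_nat (k choose j)) (step_op j (moment_poly (k - j) n)))"
  shows "moment_poly k = g"
proof
  fix n
  show "moment_poly k n = g n"
    using solve_rec_unique[of g, OF assms(3), of n] moment_poly_solve_rec[OF assms(1)] assms(2) by simp
qed

text \<open>Evaluation at a point turns the recurrences for the closed forms into ring identities;
  only \<open>\<bar>b\<bar> \<le> 2\<close> occurs in them.\<close>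

lemma poly_ladder_seq:
  "poly (ladder_seq 0 e i n) x = of_nat n ^ e * x ^ (n + i)"
  "poly (ladder_seq 1 e i n) x = of_nat n ^ e * (x * (x - 1) ^ (n + i))"
  "poly (ladder_seq 2 e i n) x = of_nat n ^ e * (x * (x - 1) * (x - 2) ^ (n + i))"
  "poly (ladder_seq (- 1) e i n) x = of_nat n ^ e * (x + 1) ^ (n + i)"
  "poly (ladder_seq (- 2) e i n) x = of_nat n ^ e * (x + 2) ^ (n + i)"
  by (simp_all add: ladder_seq_def ladder_def poly_raising poly_shifting poly_power numeral_2_eq_2 funpow_Suc_right
      diff_diff_eq add.assoc)

lemma bell_functional_ladder_seq:
  "bell_functional (ladder_seq 0 e i n) = of_nat n ^ e * of_nat (bell (n + i))"
  "bell_functional (ladder_seq 1 e i n) = of_nat n ^ e * of_nat (bell (n + i))"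
  "bell_functional (ladder_seq 2 e i n) = of_nat n ^ e * of_nat (bell (n + i))"
  "bell_functional (ladder_seq (- 1) e i n) = of_nat n ^ e * of_nat (bell (n + i + 1))"
  "bell_functional (ladder_seq (- 2) e i n) = of_nat n ^ e * (of_nat (bell (n + i + 2)) - of_nat (bell (n + i + 1)))"
proof -
  have \<xi>: "bell_functional (\<xi> * \<xi> ^ m) = of_nat (bell (Suc m))" for m
    using bell_functional_power[of "Suc m"] by simp
  \<comment> \<open>One \<open>D\<close> has become \<open>\<xi>\<close>; commuting it past the
    other produces the negative Bell number.\<close>
  have "\<xi> * shifting f = shifting (\<xi> * f) - shifting f" for f
    by (simp add: shifting_mult_\<xi>)
  then have "bell_functional (shifting (shifting (\<xi> ^ m))) = of_nat (bell (m + 2)) - of_nat (bell (m + 1))" for m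
    using \<xi>[of "Suc m"] \<xi>[of m] by (simp add: bell_functional_shifting bell_functional_diff)
  then show "bell_functional (ladder_seq (- 2) e i n) = of_nat n ^ e * (of_nat (bell (n + i + 2)) - of_nat (bell (n + i + 1)))"
    by (simp add: ladder_seq_def ladder_def bell_functional_smult numeral_2_eq_2)
qed (simp_all add: ladder_seq_def ladder_def bell_functional_smult bell_functional_raising bell_functional_power bell_functional_shifting numeral_2_eq_2
   flip: power_Suc)

text \<open>The coefficients below result from solving the recurrence term by term, as in the proofs of
  \<open>solve_rec_ladder_seq_nonzero\<close> and \<open>solve_rec_ladder_seq_zero\<close>.\<close>

lemma moment_poly_1: "moment_poly 1 = (\<lambda>n. ladder_seq (- 1) 0 0 n - ladder_seq (- 1) 0 1 n + smult 2 (ladder_seq 0 0 1 n)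
    - ladder_seq 0 0 2 n + ladder_seq 0 1 1 n + ladder_seq 1 0 1 n)"
  (is "_ = ?g")
proof (rule moment_poly_eqI)
  show "?g 0 = 0"
    by (rule rat_poly_eqI) (simp add: poly_ladder_seq algebra_simps power2_eq_square)
  show "?g (Suc n) = \<xi> * ?g n + (\<Sum>j\<in>{1..1}. smult (of_nat (1 choose j)) (step_op j (moment_poly (1 - j) n)))" for n
    by (rule rat_poly_eqI)
      (simp add: poly_ladder_seq moment_poly_zero step_op_1[simplified] poly_raising poly_shifting poly_power algebra_simps power2_eq_square)
qed simp

lemma moment_poly_2: "moment_poly 2 = (\<lambda>n. 
    ladder_seq (- 2) 0 0 n - smult (5/2) (ladder_seq (- 2) 0 1 n) + ladder_seq (- 2) 0 2 n
    + ladder_seq (- 1) 0 0 n + ladder_seq (- 1) 0 1 n - smult 4 (ladder_seq (- 1) 0 2 n) + smult 2 (ladder_seq (- 1) 0 3 n)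
    + smult 2 (ladder_seq (- 1) 1 1 n) - smult 2 (ladder_seq (- 1) 1 2 n)
    - smult (5/2) (ladder_seq 0 0 1 n) + smult (3/2) (ladder_seq 0 0 2 n) - smult (11/2) (ladder_seq 0 0 3 n) + ladder_seq 0 0 4 n
    + ladder_seq 0 1 0 n - smult 4 (ladder_seq 0 1 1 n) + smult 4 (ladder_seq 0 1 2 n) - smult 2 (ladder_seq 0 1 3 n) + ladder_seq 0 2 2 n
    - ladder_seq 1 0 1 n + smult 2 (ladder_seq 1 0 2 n) - smult 2 (ladder_seq 1 0 3 n) + smult 2 (ladder_seq 1 1 2 n)
    + smult (1/2) (ladder_seq 2 0 1 n) + ladder_seq 2 0 2 n)"
  (is "_ = ?g")
proof (rule moment_poly_eqI)
  show "?g 0 = 0"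
    by (rule rat_poly_eqI) (simp add: poly_ladder_seq power2_eq_square power3_eq_cube power4_eq_xxxx algebra_simps)
  fix n
  have s: "(\<Sum>j\<in>{1..2}. smult (of_nat (2 choose j)) (step_op j (moment_poly (2 - j) n))) =
    smult 2 (step_op 1 (moment_poly 1 n)) + step_op 2 (\<xi> ^ n)"
    by (simp add: numeral_2_eq_2 moment_poly_zero)
  show "?g (Suc n) = \<xi> * ?g n +
    (\<Sum>j\<in>{1..2}. smult (of_nat (2 choose j)) (step_op j (moment_poly (2 - j) n)))"
    unfolding s moment_poly_1 step_op_1
    by (rule rat_poly_eqI)
      (simp add: poly_ladder_seq step_op_def number_op_def numeral_2_eq_2 poly_raising poly_shifting poly_power
        power_add power_numeral_reduce algebra_simps)
qed simp

lemma dim_moment_1: "dim_moment 1 n = - 2 * int (bell (n + 2)) + (int n + 4) * int (bell (n + 1))"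
proof -
  have "(of_int (dim_moment 1 n) :: rat) = of_int (- 2 * int (bell (n + 2)) + (int n + 4) * int (bell (n + 1)))"
    unfolding bell_functional_moment_poly[symmetric] moment_poly_1
    by (simp add: bell_functional_add bell_functional_diff bell_functional_smult bell_functional_ladder_seq algebra_simps)
  then show ?thesis by (simp only: of_int_eq_iff)
qed

lemma dim_moment_2: "dim_moment 2 n = 4 * int (bell (n + 4)) - (4 * int n + 15) * int (bell (n + 3))
    + ((int n)\<^sup>2 + 8 * int n + 9) * int (bell (n + 2))
    - (4 * int n + 3) * int (bell (n + 1)) + int n * int (bell n)" (is "_ = ?r")
proof -
  have "(of_int (dim_moment 2 n) :: rat) = of_int ?r"
    unfolding bell_functional_moment_poly[symmetric] moment_poly_2
    by (simp add: bell_functional_add bell_functional_diff bell_functional_smult bell_functional_ladder_seq eval_nat_numeral algebra_simps)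
  then show ?thesis by (simp only: of_int_eq_iff)
qed

text \<open>From \<open>2 * d + j \<le> 3 * k\<close> the number \<open>(j - k) / 2\<close> is at
  most the integer \<open>k - d\<close>, hence so is its ceiling.\<close>

lemma ceiling_half_bound:
  assumes "j \<le> 2 * k" "k < j" "2 * d \<le> k + (2 * k - j)"
  shows "int d \<le> int k - \<lceil>(of_nat j - of_nat k) / 2 :: rat\<rceil>"
proof -
  have "2 * d + j \<le> 3 * k" using assms by linarith
  then have "(of_nat (2 * d + j) :: rat) \<le> of_nat (3 * k)" by (simp only: of_nat_le_iff)
  then have "(of_nat j - of_nat k) / 2 \<le> (of_int (int k - int d) :: rat)" by simp
  then have "\<lceil>(of_nat j - of_nat k) / 2 :: rat\<rceil> \<le> int k - int d" by (simp only: ceiling_le_iff)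
  then show ?thesis by linarith
qed

theorem theorem3p2:
  shows "(\<forall>k::nat. \<exists>P :: nat \<Rightarrow> rat poly.
           (\<forall>n::nat. of_int (dim_moment k n)
              = (\<Sum>i = 0..2 * k. poly (P i) (of_nat n) * of_nat (bell (n + i)))) \<and>
           (\<forall>j \<le> 2 * k.
              (j \<le> k \<longrightarrow> degree (P (2 * k - j)) \<le> j) \<and>
              (j > k \<longrightarrow> int (degree (P (2 * k - j)))
                            \<le> int k - \<lceil>(of_nat j - of_nat k) / 2 :: rat\<rceil>)))
       \<and> (\<forall>n::nat. dim_moment 1 n
            = - 2 * int (bell (n + 2)) + (int n + 4) * int (bell (n + 1)))
       \<and> (\<forall>n::nat. dim_moment 2 n
            = 4 * int (bell (n + 4)) - (4 * int n + 15) * int (bell (n + 3))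
              + ((int n)\<^sup>2 + 8 * int n + 9) * int (bell (n + 2))
              - (4 * int n + 3) * int (bell (n + 1)) + int n * int (bell n))"
proof (intro conjI allI)
  fix k
  obtain P :: "nat \<Rightarrow> rat poly" where
    P: "\<And>n. of_int (dim_moment k n) = (\<Sum>i = 0..2 * k. poly (P i) (of_nat n) * of_nat (bell (n + i)))"
    and deg: "\<And>i. i \<le> 2 * k \<Longrightarrow> degree (P i) + i \<le> 2 * k \<and> 2 * degree (P i) \<le> k + i"
    using dim_moment_bell_comb[of k] unfolding bell_comb_def by blast
  have "(j \<le> k \<longrightarrow> degree (P (2 * k - j)) \<le> j) \<and>
      (j > k \<longrightarrow> int (degree (P (2 * k - j))) \<le> int k - \<lceil>(of_nat j - of_nat k) / 2 :: rat\<rceil>)"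
    if "j \<le> 2 * k" for j
  proof (intro conjI impI)
    show "degree (P (2 * k - j)) \<le> j" using deg[of "2 * k - j"] that by linarith
    assume "j > k"
    then show "int (degree (P (2 * k - j))) \<le> int k - \<lceil>(of_nat j - of_nat k) / 2 :: rat\<rceil>"
      using deg[of "2 * k - j"] that by (intro ceiling_half_bound) auto
  qed
  with P show "\<exists>P :: nat \<Rightarrow> rat poly.
           (\<forall>n::nat. of_int (dim_moment k n)
              = (\<Sum>i = 0..2 * k. poly (P i) (of_nat n) * of_nat (bell (n + i)))) \<and>
           (\<forall>j \<le> 2 * k.
              (j \<le> k \<longrightarrow> degree (P (2 * k - j)) \<le> j) \<and>
              (j > k \<longrightarrow> int (degree (P (2 * k - j)))
                            \<le> int k - \<lceil>(of_nat j - of_nat k) / 2 :: rat\<rceil>))"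
    by (intro exI[of _ P]) simp
qed (rule dim_moment_1 dim_moment_2)+

end
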